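(* Let $(A_0,A_1)$ be a compatible couple of quasi-normed spaces which is $K$-surjective. Let $0<\theta<1$, $0<q_0,q_1\le\infty$ with $q_0\ne q_1$, and let $b_0,b_1\in SV$. Then there exists no positive function $w$ on $(0,\infty)$ such that the estimate $$K(w(t),f;\bar A_{\theta,q_0;b_0},\bar A_{\theta,q_1;b_1})\gtrsim \|s^{-\theta-1/q_0}b_0(s)K(s,f;A_0,A_1)\|_{q_0,(0,t)}+w(t)\,\|s^{-\theta-1/q_1}b_1(s)K(s,f;A_0,A_1)\|_{q_1,(t,\infty)}$$ holds for all $f\in A_0+A_1$ and for all $t>0$.
   Context: Notation: $\|\cdot\|_{q,(a,b)}$ is the $L^q$-quasi-norm on $(a,b)$ with respect to Lebesgue measure ($1/q=0$ if $q=\infty$). $A\lesssim B$ (equivalently $B\gtrsim A$) means $A\le cB$ with a positive constant $c$ independent of the appropriate parameters (here independent of $f$ and $t$); $A\approx B$ means $A\lesssim B$ and $B\lesssim A$. Slowly varying functions: a Lebesgue measurable $b:(0,\infty)\to(0,\infty)$ is slowly varying, $b\in SV$, if for every $\varepsilon>0$ there are positive functions $g_\varepsilon$ (non-decreasing) and $g_{-\varepsilon}$ (non-increasing) on $(0,\infty)$ with $t^{\varepsilon}b(t)\approx g_\varepsilon(t)$ and $t^{-\varepsilon}b(t)\approx g_{-\varepsilon}(t)$ for all $t>0$. Compatible couple: quasi-normed spaces $A_0,A_1$ continuously embedded in the same Hausdorff topological vector space. For $f\in A_0+A_1$, $t>0$, $K(t,f;A_0,A_1)=\inf\{\|f_0\|_{A_0}+t\|f_1\|_{A_1}: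 f_0\in A_0,\ f_1\in A_1,\ f=f_0+f_1\}$, with the convention $\inf\emptyset=\infty$ when a $K$-functional is taken at an element outside the sum of the couple. For $0<q\le\infty$, $0\le\theta\le1$, $b\in SV$, $\bar A_{\theta,q;b}=(A_0,A_1)_{\theta,q;b}$ is the space of $f\in A_0+A_1$ with $\|f\|_{\bar A_{\theta,q;b}}=\|t^{-\theta-1/q}b(t)K(t,f;A_0,A_1)\|_{q,(0,\infty)}<\infty$. A function $\phi:(0,\infty)\to(0,\infty)$ is quasi-concave if both $\phi(t)$ and $t\phi(1/t)$ are non-decreasing. The couple $(A_0,A_1)$ is $K$-surjective if for every quasi-concave $\phi$ there is $f\in A_0+A_1$ with $\phi(t)\approx K(t,f;A_0,A_1)$, $t>0$. *)

theory Defs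
  imports "HOL-Analysis.Analysis" "HOL-Probability.Essential_Supremum"
begin

text \<open>Real scalars also cover complex spaces: by restriction of scalars a complex quasi-normed
  couple is a real one, and no notion below depends on the scalar field otherwise.\<close>

class hausdorff_tvs = real_vector + topological_ab_group_add + t2_space +
  assumes tendsto_scaleR_Pair:
    "LIM p (nhds (c :: real) \<times>\<^sub>F nhds x). fst p *\<^sub>R snd p :> nhds (c *\<^sub>R x)"

text \<open>Compatibility with the library notion: normed spaces satisfy the axiom.\<close>

instance real_normed_vector \<subseteq> hausdorff_tvs
proof
  fix c :: real and x :: 'a
  show "LIM p (nhds c \<times>\<^sub>F nhds x). fst p *\<^sub>R snd p :> nhds (c *\<^sub>R x)"
    by (intro tendsto_scaleR filterlim_fst filterlim_snd)
qed

text \<open>A space inside an ambient vector space. The values of \<open>qnorm\<close> outside \<open>points\<close> are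
  irrelevant.\<close>

record 'a qspace =
  points :: "'a set"
  qnorm :: "'a \<Rightarrow> real"

definition quasi_normed_space :: "'a::real_vector qspace \<Rightarrow> bool" where
  "quasi_normed_space A \<longleftrightarrow>
     subspace (points A) \<and>
     (\<forall>x\<in>points A. 0 \<le> qnorm A x \<and> (qnorm A x = 0 \<longleftrightarrow> x = 0)) \<and>
     (\<forall>c. \<forall>x\<in>points A. qnorm A (c *\<^sub>R x) = \<bar>c\<bar> * qnorm A x) \<and>
     (\<exists>C. \<forall>x\<in>points A. \<forall>y\<in>points A. qnorm A (x + y) \<le> C * (qnorm A x + qnorm A y))"

text \<open>Continuity of the inclusion map from the quasi-norm topology (in which the sets
  \<open>{y \<in> points A. qnorm A (y - x) < \<epsilon>}\<close> form a neighbourhood base at \<open>x\<close>) to the ambient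
  topology.\<close>

definition continuously_embedded :: "'a::hausdorff_tvs qspace \<Rightarrow> bool" where
  "continuously_embedded A \<longleftrightarrow>
     (\<forall>x\<in>points A. \<forall>U. open U \<and> x \<in> U \<longrightarrow>
        (\<exists>\<epsilon>>0. \<forall>y\<in>points A. qnorm A (y - x) < \<epsilon> \<longrightarrow> y \<in> U))"

definition compatible_couple :: "'a::hausdorff_tvs qspace \<Rightarrow> 'a qspace \<Rightarrow> bool" where
  "compatible_couple A0 A1 \<longleftrightarrow>
     quasi_normed_space A0 \<and> continuously_embedded A0 \<and>
     quasi_normed_space A1 \<and> continuously_embedded A1"

definition sum_space :: "'a::real_vector qspace \<Rightarrow> 'a qspace \<Rightarrow> 'a set" where
  "sum_space A0 A1 = {f0 + f1 | f0 f1. f0 \<in> points A0 \<and> f1 \<in> points A1}"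

text \<open>The infimum is taken in \<^typ>\<open>ennreal\<close>, where the infimum of the empty set is \<open>\<infinity>\<close>.\<close>

definition K_functional :: "'a::real_vector qspace \<Rightarrow> 'a qspace \<Rightarrow> real \<Rightarrow> 'a \<Rightarrow> ennreal" where
  "K_functional A0 A1 t f =
     Inf {ennreal (qnorm A0 f0 + t * qnorm A1 f1) | f0 f1.
            f0 \<in> points A0 \<and> f1 \<in> points A1 \<and> f = f0 + f1}"

text \<open>\<open>F x \<lesssim> G x\<close> for \<open>x \<in> S\<close>, with a finite positive constant independent of \<open>x\<close>.\<close>

definition lesssim_on :: "'x set \<Rightarrow> ('x \<Rightarrow> ennreal) \<Rightarrow> ('x \<Rightarrow> ennreal) \<Rightarrow> bool" where
  "lesssim_on S F G \<longleftrightarrow> (\<exists>c::real. c > 0 \<and> (\<forall>x\<in>S. F x \<le> ennreal c * G x))"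

definition approx_on :: "'x set \<Rightarrow> ('x \<Rightarrow> ennreal) \<Rightarrow> ('x \<Rightarrow> ennreal) \<Rightarrow> bool" where
  "approx_on S F G \<longleftrightarrow> lesssim_on S F G \<and> lesssim_on S G F"

definition slowly_varying :: "(real \<Rightarrow> real) \<Rightarrow> bool" where
  "slowly_varying b \<longleftrightarrow>
     b \<in> borel_measurable (lebesgue_on {0<..}) \<and> (\<forall>t>0. b t > 0) \<and>
     (\<forall>\<epsilon>>0.
        (\<exists>g. (\<forall>t>0. g t > 0) \<and> mono_on {0<..} g \<and>
           approx_on {0<..} (\<lambda>t. ennreal (t powr \<epsilon> * b t)) (\<lambda>t. ennreal (g t))) \<and>
        (\<exists>g. (\<forall>t>0. g t > 0) \<and> antimono_on {0<..} g \<and>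
           approx_on {0<..} (\<lambda>t. ennreal (t powr (- \<epsilon>) * b t)) (\<lambda>t. ennreal (g t))))"

text \<open>Power of an extended nonnegative number; used for exponents \<open>p > 0\<close> only.\<close>

definition ennreal_powr :: "ennreal \<Rightarrow> real \<Rightarrow> ennreal" where
  "ennreal_powr x p = (if x = \<infinity> then \<infinity> else ennreal (enn2real x powr p))"

text \<open>The \<open>L\<^sup>q\<close>-quasi-norm on \<open>S\<close> with respect to Lebesgue measure, for \<open>0 < q \<le> \<infinity>\<close>.\<close>

definition Lq_norm :: "ennreal \<Rightarrow> real set \<Rightarrow> (real \<Rightarrow> ennreal) \<Rightarrow> ennreal" where
  "Lq_norm q S g =
     (if q = \<infinity> then esssup (lebesgue_on S) g
      else ennreal_powr (\<integral>\<^sup>+ s. ennreal_powr (g s) (enn2real q) \<partial>lebesgue_on S) (1 / enn2real q))"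

text \<open>\<open>\<parallel>s\<^bsup>-\<theta>-1/q\<^esup> b(s) K(s, f; A\<^sub>0, A\<^sub>1)\<parallel>\<close> in \<open>L\<^sup>q(S)\<close>. In \<^typ>\<open>ennreal\<close>, \<open>1 / \<infinity> = 0\<close>.\<close>

definition weighted_K_norm ::
  "'a::real_vector qspace \<Rightarrow> 'a qspace \<Rightarrow> real \<Rightarrow> ennreal \<Rightarrow> (real \<Rightarrow> real) \<Rightarrow> real set \<Rightarrow> 'a \<Rightarrow> ennreal"
  where
  "weighted_K_norm A0 A1 \<theta> q b S f =
     Lq_norm q S (\<lambda>s. ennreal (s powr (- \<theta> - enn2real (1 / q)) * b s) * K_functional A0 A1 s f)"

definition interpolation_space ::
  "'a::real_vector qspace \<Rightarrow> 'a qspace \<Rightarrow> real \<Rightarrow> ennreal \<Rightarrow> (real \<Rightarrow> real) \<Rightarrow> 'a qspace" where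
  "interpolation_space A0 A1 \<theta> q b =
     \<lparr>points = {f \<in> sum_space A0 A1. weighted_K_norm A0 A1 \<theta> q b {0<..} f < \<infinity>},
      qnorm = (\<lambda>f. enn2real (weighted_K_norm A0 A1 \<theta> q b {0<..} f))\<rparr>"

definition quasi_concave :: "(real \<Rightarrow> real) \<Rightarrow> bool" where
  "quasi_concave \<phi> \<longleftrightarrow>
     (\<forall>t>0. \<phi> t > 0) \<and> mono_on {0<..} \<phi> \<and> mono_on {0<..} (\<lambda>t. t * \<phi> (1 / t))"

definition K_surjective :: "'a::real_vector qspace \<Rightarrow> 'a qspace \<Rightarrow> bool" where
  "K_surjective A0 A1 \<longleftrightarrow>
     (\<forall>\<phi>. quasi_concave \<phi> \<longrightarrow>
        (\<exists>f\<in>sum_space A0 A1. approx_on {0<..} (\<lambda>t. ennreal (\<phi> t)) (\<lambda>t. K_functional A0 A1 t f)))"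

end

theory Submission
  imports Defs
begin

text \<open>Suppose that such a function \<open>w\<close> exists. Put \<open>p\<^sub>i = 1 / q\<^sub>i\<close> and \<open>r = b\<^sub>0 / b\<^sub>1\<close>, and write
  \<open>N\<^sub>i(f; S)\<close> for the norm of \<open>s\<^bsup>-\<theta>-1/q\<^sub>i\<^esup> b\<^sub>i(s) K(s, f)\<close> in \<open>L\<^bsup>q\<^sub>i\<^esup>(S)\<close>. The decompositions \<open>f = f + 0\<close> and
  \<open>f = 0 + f\<close> bound the \<open>K\<close>-functional of the two interpolation spaces at \<open>w(t)\<close> by
  \<open>N\<^sub>0(f; (0, \<infinity>))\<close> and by \<open>w(t) N\<^sub>1(f; (0, \<infinity>))\<close>. The assumed estimate therefore implies the two
  inequalities \<open>w(t) N\<^sub>1(f; (t, \<infinity>)) \<lesssim> N\<^sub>0(f; (0, \<infinity>))\<close> and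
  \<open>N\<^sub>0(f; (0, t)) \<lesssim> w(t) N\<^sub>1(f; (0, \<infinity>))\<close>, and these contradict each other.

  They are tested on quasi-concave functions in place of \<open>K(s, f)\<close>. For a slowly varying weight \<open>b\<close>
  let the plateau over \<open>[a, T]\<close> be the least quasi-concave majorant of \<open>s\<^bsup>\<theta>\<^esup> / b(s)\<close> on \<open>[a, T]\<close>.
  Multiplied by \<open>s\<^bsup>-\<theta>\<^esup> b(s)\<close> it is of size \<open>1\<close> on \<open>[a, T]\<close> and decays like a power outside, so with
  \<open>L = ln (T / a) \<ge> 1\<close> its norm with weight \<open>b\<close> and exponent \<open>q\<close> is of order \<open>L\<^bsup>1/q\<^esup>\<close>
  (\<open>plateau_bounds\<close>), while the norm with other parameters \<open>b'\<close> and \<open>q'\<close> is at least \<open>L\<^bsup>1/q'\<^esup>\<close> times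
  the infimum of \<open>b' / b\<close> on \<open>(a, T)\<close> (\<open>plateau_norm_lower_bound\<close>). Hence \<open>w(t) L\<^bsup>p\<^sub>1\<^esup> \<lesssim> L\<^bsup>p\<^sub>0\<^esup> sup r\<close> for
  \<open>t \<le> a\<close> and \<open>L\<^bsup>p\<^sub>0\<^esup> inf r \<lesssim> w(t) L\<^bsup>p\<^sub>1\<^esup>\<close> for \<open>T \<le> t\<close>, with \<open>sup\<close> and \<open>inf\<close> over \<open>(a, T)\<close>. With \<open>L = 1\<close>
  these say that \<open>w\<close> is comparable to \<open>r\<close> and that \<open>r\<close> is almost increasing; with large \<open>L\<close> they say
  that \<open>r\<close> gains a factor of order \<open>L\<^bsup>\<bar>p\<^sub>0 - p\<^sub>1\<bar>\<^esup>\<close> from \<open>a\<close> to \<open>T\<close>. As \<open>p\<^sub>0 \<noteq> p\<^sub>1\<close>, a fixed large \<open>L\<close>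
  makes \<open>r\<close> double over every interval of that length, so \<open>r\<close> grows at least like a power, which is
  impossible for a quotient of slowly varying functions (\<open>weight_gap_contradiction\<close>).

  One difficulty is that \<open>K\<close>-surjectivity realises each quasi-concave function only up to constants that
  depend on the function, whereas the argument needs constants uniform in \<open>a\<close>, \<open>T\<close> and \<open>t\<close>. A gliding
  hump argument, \<open>uniform_boundedness_quasi_concave\<close>, recovers the uniformity: a failing sequence of
  plateaus would combine into a single quasi-concave function for which the inequality has no constant
  at all.\<close>

section \<open>Lebesgue quasi-norms\<close>

lemma ennreal_powr_ennreal: "0 \<le> x \<Longrightarrow> ennreal_powr (ennreal x) p = ennreal (x powr p)"
  by (simp add: ennreal_powr_def)

lemma ennreal_powr_mono: "x \<le> y \<Longrightarrow> 0 \<le> p \<Longrightarrow> ennreal_powr x p \<le> ennreal_powr y p"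
  by (auto simp: ennreal_powr_def top_unique less_top intro!: ennreal_leI powr_mono2 enn2real_mono)

lemma ennreal_powr_cmult:
  assumes "0 < c"
  shows "ennreal_powr (ennreal c * x) p = ennreal (c powr p) * ennreal_powr x p"
proof (cases x)
  case (real r)
  then show ?thesis
    using assms by (simp add: ennreal_mult[symmetric] ennreal_powr_ennreal powr_mult)
next
  case top
  then show ?thesis
    using assms by (simp add: ennreal_powr_def ennreal_mult_top)
qed

lemma ennreal_powr_powr_inverse:
  assumes "0 < p"
  shows "ennreal_powr (ennreal_powr x p) (1 / p) = x"
  by (cases x) (use assms in \<open>simp_all add: ennreal_powr_def powr_powr\<close>)

lemma measurable_ennreal_powr [measurable (raw)]:
  assumes [measurable]: "g \<in> borel_measurable M"
  shows "(\<lambda>x. ennreal_powr (g x) p) \<in> borel_measurable M"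
  unfolding ennreal_powr_def by measurable

text \<open>For \<open>q = \<infinity>\<close> the exponent \<open>enn2real (1 / q)\<close> is \<open>0\<close>, so that formulas in \<open>1 / q\<close> cover the
  endpoint without change.\<close>

lemma exponent_cases [consumes 1, case_names infinite finite]:
  fixes q :: ennreal
  assumes "0 < q"
  obtains "q = top" "enn2real (1 / q) = 0"
  | r where "q = ennreal r" "0 < r" "enn2real (1 / q) = 1 / r"
proof (cases q)
  case (real r)
  then have "0 < r" using assms by simp
  moreover have "enn2real (1 / q) = 1 / r"
    using real \<open>0 < r\<close> by (metis divide_ennreal enn2real_ennreal ennreal_1 divide_nonneg_nonneg zero_le_one)
  ultimately show ?thesis using that(2) real by blast
next
  case top
  then show ?thesis using that(1) by simp
qed

lemma inverse_exponent_inj: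
  assumes "0 < q0" "0 < q1" "enn2real (1 / q0) = enn2real (1 / q1)"
  shows "q0 = q1"
  using assms(1)
proof (cases q0 rule: exponent_cases)
  case infinite
  with assms(2,3) show ?thesis by (cases q1 rule: exponent_cases) auto
next
  case (finite r)
  with assms(2,3) show ?thesis by (cases q1 rule: exponent_cases) auto
qed

lemma Lq_norm_top: "Lq_norm top S g = esssup (lebesgue_on S) g"
  by (simp add: Lq_norm_def)

lemma Lq_norm_finite:
  "0 < r \<Longrightarrow> Lq_norm (ennreal r) S g =
     ennreal_powr (\<integral>\<^sup>+ s. ennreal_powr (g s) r \<partial>lebesgue_on S) (1 / r)"
  by (simp add: Lq_norm_def)

text \<open>If \<open>h\<close> is not measurable, then the right-hand side is \<open>top\<close> for \<open>q = \<infinity>\<close>; for finite \<open>q\<close>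
  the nonnegative integral is monotone on all functions.\<close>

lemma Lq_norm_mono:
  assumes q: "0 < q"
    and S: "S \<in> sets lebesgue" and T: "T \<in> sets lebesgue" and "S \<subseteq> T"
    and g: "g \<in> borel_measurable (lebesgue_on S)"
    and le: "\<And>s. s \<in> S \<Longrightarrow> g s \<le> h s"
  shows "Lq_norm q S g \<le> Lq_norm q T h"
  using q
proof (cases q rule: exponent_cases)
  case infinite
  have "AE s in lebesgue. s \<in> T \<longrightarrow> h s \<le> esssup (lebesgue_on T) h"
    using esssup_AE[of h "lebesgue_on T"] T by (subst (asm) AE_restrict_space_iff) auto
  then have "AE s in lebesgue. s \<in> S \<longrightarrow> g s \<le> esssup (lebesgue_on T) h"
    using \<open>S \<subseteq> T\<close> by (auto elim!: eventually_mono intro: order_trans[OF le])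
  then have "AE s in lebesgue_on S. g s \<le> esssup (lebesgue_on T) h"
    using S by (subst AE_restrict_space_iff) auto
  then show ?thesis
    using g infinite(1) by (auto simp: Lq_norm_top)
next
  case (finite r)
  have "(\<integral>\<^sup>+ s. ennreal_powr (g s) r \<partial>lebesgue_on S) \<le> (\<integral>\<^sup>+ s. ennreal_powr (h s) r \<partial>lebesgue_on T)"
    using S T \<open>S \<subseteq> T\<close> finite(2) le
    by (auto simp: nn_integral_restrict_space indicator_def intro!: nn_integral_mono ennreal_powr_mono)
  then show ?thesis
    using finite by (simp add: Lq_norm_finite ennreal_powr_mono)
qed

lemma Lq_norm_cmult_le:
  assumes q: "0 < q" and "0 < c" and g: "g \<in> borel_measurable (lebesgue_on S)"
  shows "Lq_norm q S (\<lambda>s. ennreal c * g s) \<le> ennreal c * Lq_norm q S g"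
  using q
proof (cases q rule: exponent_cases)
  case infinite
  have "AE s in lebesgue_on S. ennreal c * g s \<le> ennreal c * esssup (lebesgue_on S) g"
    using esssup_AE[of g "lebesgue_on S"] by (auto elim!: eventually_mono intro: mult_left_mono)
  then show ?thesis
    using g infinite(1) by (auto simp: Lq_norm_top)
next
  case (finite r)
  then show ?thesis
    using g \<open>0 < c\<close>
    by (simp add: Lq_norm_finite ennreal_powr_cmult nn_integral_cmult powr_powr)
qed

text \<open>The reverse inequality, from the previous one applied with the factor \<open>1 / c\<close>.\<close>

lemma Lq_norm_cmult_ge:
  assumes q: "0 < q" and c: "0 < c" and g: "g \<in> borel_measurable (lebesgue_on S)"
  shows "ennreal c * Lq_norm q S g \<le> Lq_norm q S (\<lambda>s. ennreal c * g s)"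
proof -
  have inv: "ennreal (1 / c) * (ennreal c * x) = x" "ennreal c * (ennreal (1 / c) * x) = x" for x
    using c by (simp_all add: mult.assoc[symmetric] ennreal_mult[symmetric])
  have "Lq_norm q S g = Lq_norm q S (\<lambda>s. ennreal (1 / c) * (ennreal c * g s))"
    by (simp add: inv)
  also have "\<dots> \<le> ennreal (1 / c) * Lq_norm q S (\<lambda>s. ennreal c * g s)"
    using c g by (intro Lq_norm_cmult_le[OF q]) auto
  finally have "ennreal c * Lq_norm q S g
      \<le> ennreal c * (ennreal (1 / c) * Lq_norm q S (\<lambda>s. ennreal c * g s))"
    by (rule mult_left_mono) simp
  then show ?thesis by (simp add: inv)
qed

lemma Lq_norm_zero:
  assumes "0 < q"
  shows "Lq_norm q S (\<lambda>_. 0) = 0"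
  using assms
proof (cases q rule: exponent_cases)
  case infinite
  have "esssup (lebesgue_on S) (\<lambda>_. 0 :: ennreal) \<le> 0"
    by (rule esssup_I) auto
  then show ?thesis unfolding infinite(1) Lq_norm_top by simp
next
  case (finite r)
  then show ?thesis by (simp add: Lq_norm_finite ennreal_powr_def)
qed

lemma nn_integral_lebesgue_on_has_integral:
  fixes h :: "real \<Rightarrow> real"
  assumes S: "S \<in> sets lborel" and h: "\<And>s. s \<in> S \<Longrightarrow> 0 \<le> h s" and I: "(h has_integral I) S"
  shows "(\<integral>\<^sup>+ s. ennreal (h s) \<partial>lebesgue_on S) = ennreal I"
proof -
  have "(\<integral>\<^sup>+ s. ennreal (h s) \<partial>lebesgue_on S)
      = (\<integral>\<^sup>+ s. ennreal (h s) * indicator S s \<partial>lborel)"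
    using S by (simp add: nn_integral_restrict_space nn_integral_completion)
  then show ?thesis
    using nn_integral_has_integral_lebesgue'[OF h I] by simp
qed

text \<open>The conditions \<open>0 < a\<close> and \<open>exp 1 * a \<le> T\<close> normalise an interval so that its length
  \<open>ln (T / a)\<close> for the measure \<open>ds / s\<close> is at least \<open>1\<close>; then additive constants next to that
  length can be absorbed into it.\<close>

lemma one_le_ln_ratio:
  fixes a T :: real
  assumes "0 < a" "exp 1 * a \<le> T"
  shows "1 \<le> ln (T / a)"
proof -
  have "exp 1 \<le> T / a" using assms by (simp add: pos_le_divide_eq)
  then show ?thesis using ln_ge_iff less_le_trans[OF exp_gt_zero] by blast
qed

lemma less_if_exp_one_mult_le:
  fixes a T :: real
  assumes "0 < a" "exp 1 * a \<le> T"
  shows "a < T"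
proof -
  have "1 * a < exp 1 * a" using assms(1) by (intro mult_strict_right_mono) auto
  then show ?thesis using assms(2) by linarith
qed

text \<open>The \<open>q\<close>-th power of \<open>s powr - (1 / q)\<close> is \<open>1 / s\<close>, whose integral over \<open>(a, T)\<close> is
  \<open>ln (T / a)\<close>. For \<open>q = \<infinity>\<close> the claim is that the essential supremum is at least \<open>m\<close>.\<close>

lemma Lq_norm_lower_bound_log:
  assumes q: "0 < q" and "0 < a" and aT: "exp 1 * a \<le> T" and "{a<..<T} \<subseteq> S"
    and S: "S \<in> sets lebesgue" and "0 \<le> m"
    and le: "\<And>s. a < s \<Longrightarrow> s < T \<Longrightarrow> ennreal (m * s powr - enn2real (1 / q)) \<le> g s"
  shows "ennreal (m * ln (T / a) powr enn2real (1 / q)) \<le> Lq_norm q S g"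
proof -
  have "a < T" using less_if_exp_one_mult_le[OF \<open>0 < a\<close> aT] .
  have pos: "0 < ln (T / a)" using \<open>a < T\<close> \<open>0 < a\<close> by simp
  have "Lq_norm q {a<..<T} (\<lambda>s. ennreal (m * s powr - enn2real (1 / q))) \<le> Lq_norm q S g"
    by (rule Lq_norm_mono)
       (use assms in \<open>auto intro!: measurable_restrict_space1 measurable_completion\<close>)
  moreover have "ennreal (m * ln (T / a) powr enn2real (1 / q))
      = Lq_norm q {a<..<T} (\<lambda>s. ennreal (m * s powr - enn2real (1 / q)))"
    using q
  proof (cases q rule: exponent_cases)
    case infinite
    have "esssup (lebesgue_on {a<..<T}) (\<lambda>_. ennreal m) = ennreal m"
      by (rule esssup_const) (use \<open>a < T\<close> in \<open>simp add: emeasure_restrict_space\<close>)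
    moreover have "esssup (lebesgue_on {a<..<T}) (\<lambda>s. ennreal (m * s powr - 0)) =
        esssup (lebesgue_on {a<..<T}) (\<lambda>_. ennreal m)"
    proof (rule esssup_AE_cong)
      show "(\<lambda>s. ennreal (m * s powr - 0)) \<in> borel_measurable (lebesgue_on {a<..<T})"
        by (intro measurable_restrict_space1 measurable_completion) measurable
      show "AE s in lebesgue_on {a<..<T}. ennreal (m * s powr - 0) = ennreal m"
        using \<open>0 < a\<close> by (intro AE_I2) auto
    qed simp
    ultimately show ?thesis
      using infinite pos by (simp add: Lq_norm_top)
  next
    case (finite r)
    have "((\<lambda>s. 1 / s) has_integral (ln T - ln a)) {a..T}"
      using \<open>a < T\<close> \<open>0 < a\<close>
      by (intro fundamental_theorem_of_calculus)
         (auto intro!: derivative_eq_intros simp flip: has_real_derivative_iff_has_vector_derivative)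
    then have "((\<lambda>s. m powr r * (1 / s)) has_integral (m powr r * ln (T / a))) {a<..<T}"
      using \<open>a < T\<close> \<open>0 < a\<close>
      by (intro has_integral_mult_right) (simp add: ln_div has_integral_Icc_iff_Ioo)
    then have "(\<integral>\<^sup>+ s. ennreal (m powr r * (1 / s)) \<partial>lebesgue_on {a<..<T})
        = ennreal (m powr r * ln (T / a))"
      using \<open>0 < a\<close> by (intro nn_integral_lebesgue_on_has_integral) auto
    also have "(\<integral>\<^sup>+ s. ennreal (m powr r * (1 / s)) \<partial>lebesgue_on {a<..<T})
        = (\<integral>\<^sup>+ s. ennreal_powr (ennreal (m * s powr - (1 / r))) r \<partial>lebesgue_on {a<..<T})"
      using \<open>0 < a\<close> \<open>0 < r\<close> \<open>0 \<le> m\<close>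
      by (intro nn_integral_cong)
         (auto simp: ennreal_powr_ennreal powr_mult powr_divide powr_powr powr_minus_divide)
    finally show ?thesis
      using finite pos \<open>0 \<le> m\<close>
      by (simp add: Lq_norm_finite ennreal_powr_ennreal powr_mult powr_powr)
  qed
  ultimately show ?thesis by simp
qed

text \<open>The middle piece \<open>(a, T)\<close> contributes the logarithm and each of the two power tails
  contributes \<open>1 / p\<close>.\<close>

lemma nn_integral_plateau:
  assumes "0 < a" "a < T" "0 < p"
  shows "(\<integral>\<^sup>+ s. ennreal (min 1 (min (s / a) (T / s)) powr p / s) \<partial>lebesgue_on {0<..})
       \<le> ennreal (ln (T / a) + 2 / p)"
proof -
  let ?E = "\<lambda>s::real. min 1 (min (s / a) (T / s)) powr p / s"
  let ?f1 = "\<lambda>s. indicator {0..a} s * (a powr - p * s powr (p - 1))"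
  let ?f2 = "\<lambda>s. indicator {a..T} s * (1 / s)"
  let ?f3 = "\<lambda>s. indicator {T..} s * (T powr p * s powr (- p - 1))"
  have "0 < T" using assms by simp
  have "(\<integral>\<^sup>+ s. ennreal (?E s) \<partial>lebesgue_on {0<..})
      = (\<integral>\<^sup>+ s. ennreal (?E s) * indicator {0<..} s \<partial>lborel)"
    by (simp add: nn_integral_restrict_space nn_integral_completion)
  also have "\<dots> \<le> (\<integral>\<^sup>+ s. (ennreal (?f1 s) + ennreal (?f2 s)) + ennreal (?f3 s) \<partial>lborel)"
  proof (rule nn_integral_mono)
    fix s :: real
    consider "s \<le> 0" | "0 < s" "s \<le> a" | "a < s" "s \<le> T" | "T < s" by linarith
    then show "ennreal (?E s) * indicator {0<..} s
        \<le> (ennreal (?f1 s) + ennreal (?f2 s)) + ennreal (?f3 s)"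
    proof cases
      case 2
      have "?E s \<le> (s / a) powr p / s"
        using 2 assms \<open>0 < T\<close> by (intro divide_right_mono powr_mono2) auto
      also have "\<dots> = ?f1 s"
        using 2 assms by (simp add: powr_divide powr_diff powr_minus_divide)
      finally show ?thesis
        using 2 by (intro add_increasing2) (auto intro!: ennreal_leI)
    next
      case 3
      have "?E s \<le> 1 powr p / s"
        using 3 assms \<open>0 < T\<close> by (intro divide_right_mono powr_mono2) auto
      also have "\<dots> = ?f2 s"
        using 3 by simp
      finally have "ennreal (?E s) \<le> ennreal (?f2 s)" by (rule ennreal_leI)
      then show ?thesis
        using 3 assms by (intro add_increasing2 add_increasing) auto
    next
      case 4
      have "?E s \<le> (T / s) powr p / s"
        using 4 assms \<open>0 < T\<close> by (intro divide_right_mono powr_mono2) auto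
      also have "\<dots> = ?f3 s"
        using 4 \<open>0 < T\<close> by (simp add: powr_divide powr_diff powr_minus_divide)
      finally have "ennreal (?E s) \<le> ennreal (?f3 s)" by (rule ennreal_leI)
      then show ?thesis
        using 4 assms by (intro add_increasing) auto
    qed simp
  qed
  also have "\<dots> = (\<integral>\<^sup>+ s. ennreal (?f1 s) \<partial>lborel) + (\<integral>\<^sup>+ s. ennreal (?f2 s) \<partial>lborel)
      + (\<integral>\<^sup>+ s. ennreal (?f3 s) \<partial>lborel)"
    by (simp add: nn_integral_add)
  also have "(\<integral>\<^sup>+ s. ennreal (?f1 s) \<partial>lborel) = ennreal (a powr - p * (a powr p / p))"
    using has_integral_mult_right[OF has_integral_powr_from_0[of "p - 1" a], of "a powr - p"] assms
    by (intro nn_integral_has_integral_lebesgue) auto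
  also have "(\<integral>\<^sup>+ s. ennreal (?f2 s) \<partial>lborel) = ennreal (ln T - ln a)"
    using assms
    by (intro nn_integral_has_integral_lebesgue fundamental_theorem_of_calculus)
       (auto intro!: derivative_eq_intros simp flip: has_real_derivative_iff_has_vector_derivative)
  also have "(\<integral>\<^sup>+ s. ennreal (?f3 s) \<partial>lborel) = ennreal (T powr p * (T powr - p / p))"
    using has_integral_mult_right[OF has_integral_powr_to_inf[of "- p - 1" T], of "T powr p"]
      assms \<open>0 < T\<close>
    by (intro nn_integral_has_integral_lebesgue) auto
  also have "ennreal (a powr - p * (a powr p / p)) + ennreal (ln T - ln a)
      + ennreal (T powr p * (T powr - p / p)) = ennreal (ln (T / a) + 2 / p)"
    using assms \<open>0 < T\<close>
    by (simp add: powr_minus ln_div ennreal_plus[symmetric] del: ennreal_plus)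
  finally show ?thesis .
qed

text \<open>The counterpart of the logarithmic lower bound: power tails of a function that is bounded on
  \<open>(a, T)\<close> cost only a constant, uniformly in \<open>a\<close> and \<open>T\<close>.\<close>

lemma Lq_norm_upper_bound_plateau:
  assumes q: "0 < q" and \<epsilon>: "0 < \<epsilon>"
  obtains D where "0 < D"
    and "\<And>a T C g. \<lbrakk>0 < a; exp 1 * a \<le> T; 0 < C; g \<in> borel_measurable (lebesgue_on {0<..});
           \<And>s. 0 < s \<Longrightarrow>
             g s \<le> ennreal (C * (min 1 (min (s / a) (T / s)) powr \<epsilon> * s powr - enn2real (1 / q)))\<rbrakk>
         \<Longrightarrow> Lq_norm q {0<..} g \<le> ennreal (C * D * ln (T / a) powr enn2real (1 / q))"
proof -
  note ln_ge = one_le_ln_ratio less_if_exp_one_mult_le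
  show thesis
    using q
  proof (cases q rule: exponent_cases)
    case infinite
    have "Lq_norm q {0<..} g \<le> ennreal (C * 1 * ln (T / a) powr enn2real (1 / q))"
      if "0 < a" "exp 1 * a \<le> T" "0 < C" and g: "g \<in> borel_measurable (lebesgue_on {0<..})"
        and le: "\<And>s. 0 < s \<Longrightarrow>
          g s \<le> ennreal (C * (min 1 (min (s / a) (T / s)) powr \<epsilon> * s powr - enn2real (1 / q)))"
      for a T C g
    proof -
      have "g s \<le> ennreal C" if "0 < s" for s
      proof -
        have "min 1 (min (s / a) (T / s)) powr \<epsilon> \<le> 1 powr \<epsilon>"
          using ln_ge[OF \<open>0 < a\<close> \<open>exp 1 * a \<le> T\<close>] \<open>0 < s\<close> \<open>0 < a\<close> \<epsilon> by (intro powr_mono2) auto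
        then have "C * (min 1 (min (s / a) (T / s)) powr \<epsilon> * s powr - enn2real (1 / q)) \<le> C"
          using \<open>0 < C\<close> \<open>0 < s\<close> infinite by simp
        then show ?thesis using le[OF \<open>0 < s\<close>] by (meson ennreal_leI order_trans)
      qed
      then have "esssup (lebesgue_on {0<..}) g \<le> ennreal C"
        using g by (intro esssup_I AE_I2) auto
      then show ?thesis
        using infinite ln_ge[OF that(1,2)] by (simp add: Lq_norm_top)
    qed
    then show thesis by (intro that[of 1]) auto
  next
    case (finite r)
    define D where "D = (1 + 2 / (\<epsilon> * r)) powr (1 / r)"
    have "0 < 1 + 2 / (\<epsilon> * r)" using \<epsilon> finite by (simp add: add_pos_pos)
    have "Lq_norm q {0<..} g \<le> ennreal (C * D * ln (T / a) powr enn2real (1 / q))"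
      if "0 < a" "exp 1 * a \<le> T" "0 < C" and g: "g \<in> borel_measurable (lebesgue_on {0<..})"
        and le: "\<And>s. 0 < s \<Longrightarrow>
          g s \<le> ennreal (C * (min 1 (min (s / a) (T / s)) powr \<epsilon> * s powr - enn2real (1 / q)))"
      for a T C g
    proof -
      note L = ln_ge[OF that(1,2)]
      let ?E = "\<lambda>s. min 1 (min (s / a) (T / s)) powr (\<epsilon> * r) / s"
      have "(\<integral>\<^sup>+ s. ennreal_powr (g s) r \<partial>lebesgue_on {0<..})
          \<le> (\<integral>\<^sup>+ s. ennreal (C powr r) * ennreal (?E s) \<partial>lebesgue_on {0<..})"
      proof (rule nn_integral_mono)
        fix s assume "s \<in> space (lebesgue_on {0 :: real<..})"
        then have "0 < s" by simp
        have "ennreal_powr (g s) r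
            \<le> ennreal ((C * (min 1 (min (s / a) (T / s)) powr \<epsilon> * s powr - (1 / r))) powr r)"
          using ennreal_powr_mono[OF le[OF \<open>0 < s\<close>], of r] finite \<open>0 < C\<close>
          by (simp add: ennreal_powr_ennreal)
        also have "(C * (min 1 (min (s / a) (T / s)) powr \<epsilon> * s powr - (1 / r))) powr r
            = C powr r * ?E s"
          using \<open>0 < C\<close> \<open>0 < s\<close> finite(2)
          by (simp add: powr_mult powr_divide powr_powr powr_minus_divide)
        finally show "ennreal_powr (g s) r \<le> ennreal (C powr r) * ennreal (?E s)"
          using \<open>0 < s\<close> by (subst ennreal_mult[symmetric]) auto
      qed
      also have "\<dots> = ennreal (C powr r) * (\<integral>\<^sup>+ s. ennreal (?E s) \<partial>lebesgue_on {0<..})"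
        by (intro nn_integral_cmult measurable_restrict_space1 measurable_completion) measurable
      also have "\<dots> \<le> ennreal (C powr r) * ennreal (ln (T / a) + 2 / (\<epsilon> * r))"
        using L \<open>0 < a\<close> \<epsilon> finite(2) by (intro mult_left_mono nn_integral_plateau) auto
      also have "\<dots> = ennreal (C powr r * (ln (T / a) + 2 / (\<epsilon> * r)))"
        using L \<epsilon> finite(2) by (simp add: ennreal_mult)
      also have "\<dots> \<le> ennreal (C powr r * ((1 + 2 / (\<epsilon> * r)) * ln (T / a)))"
      proof (intro ennreal_leI mult_left_mono)
        have "2 / (\<epsilon> * r) * 1 \<le> 2 / (\<epsilon> * r) * ln (T / a)"
          using L \<epsilon> finite(2) by (intro mult_left_mono) auto
        then show "ln (T / a) + 2 / (\<epsilon> * r) \<le> (1 + 2 / (\<epsilon> * r)) * ln (T / a)"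
          by (simp add: distrib_right)
      qed simp
      finally have "Lq_norm q {0<..} g
          \<le> ennreal_powr (ennreal (C powr r * ((1 + 2 / (\<epsilon> * r)) * ln (T / a)))) (1 / r)"
        using finite by (simp add: Lq_norm_finite ennreal_powr_mono)
      also have "\<dots> = ennreal ((C powr r * ((1 + 2 / (\<epsilon> * r)) * ln (T / a))) powr (1 / r))"
        using \<open>0 < 1 + 2 / (\<epsilon> * r)\<close> L by (intro ennreal_powr_ennreal) auto
      also have "(C powr r * ((1 + 2 / (\<epsilon> * r)) * ln (T / a))) powr (1 / r)
          = C * D * ln (T / a) powr (1 / r)"
        using \<open>0 < C\<close> \<open>0 < r\<close> by (simp add: powr_mult powr_powr D_def)
      finally show ?thesis using finite by simp
    qed
    then show thesis
      using \<open>0 < 1 + 2 / (\<epsilon> * r)\<close> by (intro that[of D]) (auto simp: D_def)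
  qed
qed

section \<open>Slowly varying weights\<close>

text \<open>The norm of the interpolation space as a functional of an arbitrary function \<open>k\<close> in place
  of the \<open>K\<close>-functional, so that it can be applied to quasi-concave functions as well.\<close>

definition weighted_norm ::
  "real \<Rightarrow> ennreal \<Rightarrow> (real \<Rightarrow> real) \<Rightarrow> real set \<Rightarrow> (real \<Rightarrow> ennreal) \<Rightarrow> ennreal" where
  "weighted_norm \<theta> q b S k =
     Lq_norm q S (\<lambda>s. ennreal (s powr (- \<theta> - enn2real (1 / q)) * b s) * k s)"

lemma slowly_varying_pos: "slowly_varying b \<Longrightarrow> 0 < t \<Longrightarrow> 0 < b t"
  by (simp add: slowly_varying_def)

lemma slowly_varying_measurable:
  "slowly_varying b \<Longrightarrow> S \<subseteq> {0<..} \<Longrightarrow> b \<in> borel_measurable (lebesgue_on S)"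
  using measurable_restrict_mono unfolding slowly_varying_def by blast

lemma approx_on_realE:
  assumes "approx_on S (\<lambda>t. ennreal (F t)) (\<lambda>t. ennreal (G t))"
    and "\<And>t. t \<in> S \<Longrightarrow> 0 \<le> F t" "\<And>t. t \<in> S \<Longrightarrow> 0 \<le> G t"
  obtains c d where "0 < c" "0 < d" "\<And>t. t \<in> S \<Longrightarrow> F t \<le> c * G t" "\<And>t. t \<in> S \<Longrightarrow> G t \<le> d * F t"
proof -
  obtain c d where "0 < c" "0 < d"
    and *: "\<And>t. t \<in> S \<Longrightarrow> ennreal (F t) \<le> ennreal c * ennreal (G t)"
      "\<And>t. t \<in> S \<Longrightarrow> ennreal (G t) \<le> ennreal d * ennreal (F t)"
    using assms(1) unfolding approx_on_def lesssim_on_def by auto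
  have "F t \<le> c * G t" "G t \<le> d * F t" if "t \<in> S" for t
    using *[OF that] assms(2,3)[OF that] \<open>0 < c\<close> \<open>0 < d\<close>
    by (simp_all add: ennreal_mult[symmetric])
  then show ?thesis using that \<open>0 < c\<close> \<open>0 < d\<close> by blast
qed

text \<open>A two-sided Potter-type bound: compare through the non-decreasing equivalent of
  \<open>t powr \<epsilon> * b t\<close> if \<open>s \<le> u\<close>, and through the non-increasing equivalent of
  \<open>t powr - \<epsilon> * b t\<close> otherwise.\<close>

lemma slowly_varying_ratio_bound:
  assumes "slowly_varying b" "0 < \<epsilon>"
  obtains C where "0 < C" "\<And>s u. 0 < s \<Longrightarrow> 0 < u \<Longrightarrow> b s \<le> C * max (s / u) (u / s) powr \<epsilon> * b u"
proof -
  note pos = slowly_varying_pos[OF assms(1)]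
  have "(\<exists>g. (\<forall>t>0. 0 < g t) \<and> mono_on {0<..} g \<and>
           approx_on {0<..} (\<lambda>t. ennreal (t powr \<epsilon> * b t)) (\<lambda>t. ennreal (g t))) \<and>
        (\<exists>h. (\<forall>t>0. 0 < h t) \<and> antimono_on {0<..} h \<and>
           approx_on {0<..} (\<lambda>t. ennreal (t powr (- \<epsilon>) * b t)) (\<lambda>t. ennreal (h t)))"
    using assms unfolding slowly_varying_def by simp
  then obtain g h where g: "\<And>t. 0 < t \<Longrightarrow> 0 < g t" "mono_on {0<..} g"
      "approx_on {0<..} (\<lambda>t. ennreal (t powr \<epsilon> * b t)) (\<lambda>t. ennreal (g t))"
    and h: "\<And>t. 0 < t \<Longrightarrow> 0 < h t" "antimono_on {0<..} h"
      "approx_on {0<..} (\<lambda>t. ennreal (t powr (- \<epsilon>) * b t)) (\<lambda>t. ennreal (h t))"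
    by (elim conjE exE) blast
  obtain c d where c: "0 < c" "0 < d"
      "\<And>t. t \<in> {0<..} \<Longrightarrow> t powr \<epsilon> * b t \<le> c * g t"
      "\<And>t. t \<in> {0<..} \<Longrightarrow> g t \<le> d * (t powr \<epsilon> * b t)"
    by (rule approx_on_realE[OF g(3)]) (use g(1) pos in \<open>auto simp: less_imp_le\<close>)
  obtain c' d' where c': "0 < c'" "0 < d'"
      "\<And>t. t \<in> {0<..} \<Longrightarrow> t powr - \<epsilon> * b t \<le> c' * h t"
      "\<And>t. t \<in> {0<..} \<Longrightarrow> h t \<le> d' * (t powr - \<epsilon> * b t)"
    by (rule approx_on_realE[OF h(3)]) (use h(1) pos in \<open>auto simp: less_imp_le\<close>)
  define C where "C = max (c * d) (c' * d')"
  have "0 < C" using c(1,2) by (simp add: C_def less_max_iff_disj)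
  have "b s \<le> C * max (s / u) (u / s) powr \<epsilon> * b u" if su: "0 < s" "0 < u" for s u
  proof (cases "s \<le> u")
    case True
    have "s powr \<epsilon> * b s \<le> c * g s" using su by (intro c(3)) simp
    also have "\<dots> \<le> c * g u"
      using True su c(1) mono_onD[OF g(2), of s u] by simp
    also have "\<dots> \<le> c * (d * (u powr \<epsilon> * b u))"
      using c(1,4) su by simp
    finally have "b s \<le> (c * d) * (u / s) powr \<epsilon> * b u"
      using su by (simp add: powr_divide field_simps)
    also have "\<dots> \<le> C * max (s / u) (u / s) powr \<epsilon> * b u"
      using su pos[of u] \<open>0 < C\<close> assms(2)
      by (intro mult_right_mono mult_mono powr_mono2) (auto simp: C_def)
    finally show ?thesis .
  next
    case False
    have "s powr - \<epsilon> * b s \<le> c' * h s" using su by (intro c'(3)) simp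
    also have "\<dots> \<le> c' * h u"
      using False su c'(1) monotone_onD[OF h(2), of u s] by simp
    also have "\<dots> \<le> c' * (d' * (u powr - \<epsilon> * b u))"
      using c'(1,4) su by simp
    finally have "b s \<le> (c' * d') * (s / u) powr \<epsilon> * b u"
      using su by (simp add: powr_divide powr_minus_divide field_simps)
    also have "\<dots> \<le> C * max (s / u) (u / s) powr \<epsilon> * b u"
      using su pos[of u] \<open>0 < C\<close> assms(2)
      by (intro mult_right_mono mult_mono powr_mono2) (auto simp: C_def)
    finally show ?thesis .
  qed
  with \<open>0 < C\<close> show ?thesis by (rule that)
qed

lemma mono_on_imp_lebesgue_measurable:
  fixes k :: "real \<Rightarrow> real"
  assumes "mono_on {0<..} k" "S \<subseteq> {0<..}" "S \<in> sets borel"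
  shows "k \<in> borel_measurable (lebesgue_on S)"
proof -
  have "mono_on S k" using assms(1,2) by (rule mono_on_subset)
  then have "k \<in> borel_measurable (restrict_space borel S)"
    by (rule borel_measurable_mono_on_fnc)
  then have "(\<lambda>x. indicator S x *\<^sub>R k x) \<in> borel_measurable borel"
    using assms(3) by (subst (asm) borel_measurable_restrict_space_iff) auto
  then have "(\<lambda>x. indicator S x *\<^sub>R k x) \<in> borel_measurable lebesgue"
    by (intro measurable_completion) simp
  then show ?thesis
    using assms(3) by (subst borel_measurable_restrict_space_iff) auto
qed

text \<open>Monotonicity in the set and in the function, with a scalar factor built in; every comparison of
  two weighted norms below is an instance.\<close>

lemma weighted_norm_mono:
  assumes q: "0 < q" and b: "slowly_varying b" and "S \<subseteq> T" "T \<subseteq> {0<..}"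
    and S: "S \<in> sets borel" and T: "T \<in> sets borel" and "0 < c"
    and k: "k \<in> borel_measurable (lebesgue_on S)"
    and le: "\<And>s. s \<in> S \<Longrightarrow> ennreal c * k s \<le> l s"
  shows "ennreal c * weighted_norm \<theta> q b S k \<le> weighted_norm \<theta> q b T l"
proof -
  let ?W = "\<lambda>s. ennreal (s powr (- \<theta> - enn2real (1 / q)) * b s)"
  have "b \<in> borel_measurable (lebesgue_on S)"
    using assms by (intro slowly_varying_measurable) auto
  moreover have "(\<lambda>s::real. s powr (- \<theta> - enn2real (1 / q))) \<in> borel_measurable (lebesgue_on S)"
    by (intro measurable_restrict_space1 measurable_completion) measurable
  ultimately have meas: "(\<lambda>s. ?W s * k s) \<in> borel_measurable (lebesgue_on S)"
    using k by measurable
  have "ennreal c * weighted_norm \<theta> q b S k \<le> Lq_norm q S (\<lambda>s. ennreal c * (?W s * k s))"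
    unfolding weighted_norm_def using q \<open>0 < c\<close> meas by (rule Lq_norm_cmult_ge)
  also have "\<dots> \<le> weighted_norm \<theta> q b T l"
    unfolding weighted_norm_def
  proof (rule Lq_norm_mono[OF q])
    fix s assume "s \<in> S"
    show "ennreal c * (?W s * k s) \<le> ?W s * l s"
      using mult_left_mono[OF le[OF \<open>s \<in> S\<close>], of "?W s"] by (simp add: mult.left_commute)
  qed (use S T \<open>S \<subseteq> T\<close> meas in auto)
  finally show ?thesis .
qed

section \<open>Quasi-concave functions\<close>

text \<open>Monotonicity of \<open>t * \<phi> (1 / t)\<close> says that \<open>\<phi> t / t\<close> is non-increasing; the form used
  here avoids reciprocals of the argument.\<close>

lemma quasi_concaveI:
  assumes "\<And>t. 0 < t \<Longrightarrow> 0 < \<phi> t" "\<And>s t. 0 < s \<Longrightarrow> s \<le> t \<Longrightarrow> \<phi> s \<le> \<phi> t"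
    and "\<And>s t. 0 < s \<Longrightarrow> s \<le> t \<Longrightarrow> \<phi> t \<le> t / s * \<phi> s"
  shows "quasi_concave \<phi>"
  unfolding quasi_concave_def
proof (intro conjI mono_onI allI impI)
  show "0 < \<phi> t" if "0 < t" for t using that by (rule assms(1))
  show "\<phi> s \<le> \<phi> t" if "s \<in> {0<..}" "s \<le> t" for s t
    using that by (intro assms(2)) auto
next
  fix s t :: real assume "s \<in> {0<..}" "s \<le> t"
  then have pos: "0 < s" "0 < t" "0 < 1 / t" and le: "1 / t \<le> 1 / s"
    by (auto intro: frac_le)
  have "s * \<phi> (1 / s) \<le> s * (1 / s / (1 / t) * \<phi> (1 / t))"
    using assms(3)[OF pos(3) le] pos(1) by (rule mult_left_mono[OF _ less_imp_le])
  also have "\<dots> = t * \<phi> (1 / t)"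
    using pos by simp
  finally show "s * \<phi> (1 / s) \<le> t * \<phi> (1 / t)" .
qed

lemma quasi_concave_pos: "quasi_concave \<phi> \<Longrightarrow> 0 < t \<Longrightarrow> 0 < \<phi> t"
  by (simp add: quasi_concave_def)

lemma quasi_concave_mono: "quasi_concave \<phi> \<Longrightarrow> 0 < s \<Longrightarrow> s \<le> t \<Longrightarrow> \<phi> s \<le> \<phi> t"
  using mono_onD[of "{0<..}" \<phi> s t] by (simp add: quasi_concave_def)

lemma quasi_concave_ratio:
  assumes "quasi_concave \<phi>" "0 < s" "s \<le> t"
  shows "\<phi> t \<le> t / s * \<phi> s"
proof -
  have mono: "mono_on {0<..} (\<lambda>t. t * \<phi> (1 / t))"
    using assms(1) by (simp add: quasi_concave_def)
  have pos: "0 < t" "1 / t \<in> {0<..}" "1 / s \<in> {0<..}" and le: "1 / t \<le> 1 / s"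
    using assms(2,3) by (auto intro: frac_le)
  have "1 / t * \<phi> (1 / (1 / t)) \<le> 1 / s * \<phi> (1 / (1 / s))"
    using mono_onD[OF mono pos(2,3) le] .
  from mult_left_mono[OF this less_imp_le[OF pos(1)]]
  have "t * (1 / t * \<phi> (1 / (1 / t))) \<le> t * (1 / s * \<phi> (1 / (1 / s)))" .
  moreover have "t * (1 / t * \<phi> (1 / (1 / t))) = \<phi> t" using pos by simp
  moreover have "t * (1 / s * \<phi> (1 / (1 / s))) = t / s * \<phi> s" by simp
  ultimately show ?thesis by (simp only:)
qed

lemma quasi_concave_cmult:
  assumes "quasi_concave \<phi>" "0 < c"
  shows "quasi_concave (\<lambda>s. c * \<phi> s)"
proof (rule quasi_concaveI)
  fix s t :: real assume "0 < s" "s \<le> t"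
  then show "c * \<phi> t \<le> t / s * (c * \<phi> s)"
    using mult_left_mono[OF quasi_concave_ratio[OF assms(1)], of s t c] assms(2)
    by (simp only: mult.left_commute)
qed (use assms in \<open>auto simp: quasi_concave_pos quasi_concave_mono\<close>)

lemma quasi_concave_min_line:
  assumes "0 < u"
  shows "quasi_concave (\<lambda>s. min 1 (s / u))"
proof (rule quasi_concaveI)
  fix s t :: real assume "0 < s" "s \<le> t"
  then show "min 1 (s / u) \<le> min 1 (t / u)"
    using assms by (intro min.mono divide_right_mono) auto
  have "min 1 (t / u) \<le> min (t / s) (t / u)"
    using \<open>0 < s\<close> \<open>s \<le> t\<close> by (intro min.mono) auto
  also have "\<dots> = t / s * min 1 (s / u)"
    using \<open>0 < s\<close> \<open>s \<le> t\<close> by (simp add: min_mult_distrib_left)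
  finally show "min 1 (t / u) \<le> t / s * min 1 (s / u)" .
qed (use assms in auto)

lemma quasi_concave_SUP:
  assumes "I \<noteq> {}" and qc: "\<And>i. i \<in> I \<Longrightarrow> quasi_concave (\<phi> i)"
    and bdd: "\<And>s. 0 < s \<Longrightarrow> bdd_above ((\<lambda>i. \<phi> i s) ` I)"
  shows "quasi_concave (\<lambda>s. SUP i\<in>I. \<phi> i s)"
proof (rule quasi_concaveI)
  fix t :: real assume "0 < t"
  obtain i where "i \<in> I" using \<open>I \<noteq> {}\<close> by blast
  have "0 < \<phi> i t" using qc[OF \<open>i \<in> I\<close>] \<open>0 < t\<close> by (rule quasi_concave_pos)
  also have "\<dots> \<le> (SUP i\<in>I. \<phi> i t)" using \<open>i \<in> I\<close> bdd[OF \<open>0 < t\<close>] by (rule cSUP_upper)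
  finally show "0 < (SUP i\<in>I. \<phi> i t)" .
next
  fix s t :: real assume "0 < s" "s \<le> t"
  then show "(SUP i\<in>I. \<phi> i s) \<le> (SUP i\<in>I. \<phi> i t)"
    using \<open>I \<noteq> {}\<close> bdd[of t] qc by (intro cSUP_mono) (auto intro: quasi_concave_mono)
  show "(SUP i\<in>I. \<phi> i t) \<le> t / s * (SUP i\<in>I. \<phi> i s)"
  proof (rule cSUP_least[OF \<open>I \<noteq> {}\<close>])
    fix i assume "i \<in> I"
    have "\<phi> i t \<le> t / s * \<phi> i s"
      using qc[OF \<open>i \<in> I\<close>] \<open>0 < s\<close> \<open>s \<le> t\<close> by (rule quasi_concave_ratio)
    also have "\<dots> \<le> t / s * (SUP i\<in>I. \<phi> i s)"
      using \<open>0 < s\<close> \<open>s \<le> t\<close> bdd[OF \<open>0 < s\<close>] \<open>i \<in> I\<close> by (intro mult_left_mono cSUP_upper) auto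
    finally show "\<phi> i t \<le> t / s * (SUP i\<in>I. \<phi> i s)" .
  qed
qed

lemma quasi_concave_measurable:
  "quasi_concave \<phi> \<Longrightarrow> S \<subseteq> {0<..} \<Longrightarrow> S \<in> sets borel \<Longrightarrow> \<phi> \<in> borel_measurable (lebesgue_on S)"
  by (rule mono_on_imp_lebesgue_measurable) (auto simp: quasi_concave_def)

section \<open>Plateau functions\<close>

text \<open>The least quasi-concave majorant of \<open>u powr \<theta> / b u\<close> on \<open>[a, T]\<close>: a quasi-concave
  function with value \<open>h\<close> at \<open>u\<close> is at least \<open>min 1 (s / u) * h\<close> at \<open>s\<close>.\<close>

definition plateau :: "real \<Rightarrow> (real \<Rightarrow> real) \<Rightarrow> real \<Rightarrow> real \<Rightarrow> real \<Rightarrow> real" where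
  "plateau \<theta> b a T s = (SUP u\<in>{a..T}. min 1 (s / u) * (u powr \<theta> / b u))"

text \<open>Because \<open>b\<close> varies more slowly than any power and \<open>0 < \<theta> < 1\<close>, multiplying a summand by
  \<open>s powr - \<theta> * b s\<close> gives a function of \<open>s\<close> with a peak of bounded height at \<open>u\<close> and power decay
  on both sides. Hence the plateau itself is of size \<open>1\<close> on \<open>[a, T]\<close> after this normalisation and
  decays like a power outside.\<close>

lemma plateau_summand_bound:
  assumes b: "slowly_varying b" and \<theta>: "0 < \<theta>" "\<theta> < 1"
  obtains \<epsilon> C where "0 < \<epsilon>" "0 < C"
    and "\<And>a T u s. \<lbrakk>0 < a; a \<le> u; u \<le> T; 0 < s\<rbrakk> \<Longrightarrow>
      min 1 (s / u) * (u powr \<theta> / b u)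
        \<le> C * (s powr \<theta> / b s) * min 1 (min (s / a) (T / s)) powr \<epsilon>"
proof -
  note pos = slowly_varying_pos[OF b]
  \<comment> \<open>Half of the decay \<open>\<theta>\<close> to the right and \<open>1 - \<theta>\<close> to the left of \<open>u\<close> is spent on the
    variation of \<open>b\<close>; the other half remains.\<close>
  define \<epsilon> where "\<epsilon> = min \<theta> (1 - \<theta>) / 2"
  have \<epsilon>: "0 < \<epsilon>" "2 * \<epsilon> \<le> \<theta>" "2 * \<epsilon> \<le> 1 - \<theta>"
    using \<theta> by (auto simp: \<epsilon>_def)
  obtain C where C: "0 < C"
    "\<And>s u. 0 < s \<Longrightarrow> 0 < u \<Longrightarrow> b s \<le> C * max (s / u) (u / s) powr \<epsilon> * b u"
    using slowly_varying_ratio_bound[OF b \<epsilon>(1)] by blast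
  have "min 1 (s / u) * (u powr \<theta> / b u)
      \<le> C * (s powr \<theta> / b s) * min 1 (min (s / a) (T / s)) powr \<epsilon>"
    if "0 < a" "a \<le> u" "u \<le> T" "0 < s" for a T u s
  proof -
    have u: "0 < u" using that by linarith
    let ?E = "min 1 (min (s / a) (T / s))"
    let ?m = "max (s / u) (u / s)"
    have decay: "min 1 (s / u) * (u / s) powr \<theta> * ?m powr \<epsilon> \<le> ?E powr \<epsilon>"
    proof (cases "s \<le> u")
      case True
      have "s / u \<le> 1" "1 \<le> u / s" using True u \<open>0 < s\<close> by simp_all
      then have "?m = u / s" "min 1 (s / u) = s / u" by linarith+
      then have "min 1 (s / u) * (u / s) powr \<theta> * ?m powr \<epsilon>
          = (s / u) powr (1 - \<theta> - \<epsilon>)"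
        using u \<open>0 < s\<close> by (simp add: powr_divide powr_diff)
      also have "\<dots> \<le> (s / u) powr \<epsilon>"
        using \<open>s / u \<le> 1\<close> \<epsilon> u \<open>0 < s\<close> by (intro powr_mono') auto
      also have "\<dots> \<le> ?E powr \<epsilon>"
      proof (intro powr_mono2)
        have "s / u \<le> s / a" using that u by (intro divide_left_mono) auto
        moreover have "1 \<le> T / s" using True that by simp
        ultimately show "s / u \<le> ?E" using \<open>s / u \<le> 1\<close> by linarith
      qed (use \<epsilon> u \<open>0 < s\<close> in auto)
      finally show ?thesis .
    next
      case False
      have "u / s \<le> 1" "1 \<le> s / u" using False u \<open>0 < s\<close> by simp_all
      then have "?m = s / u" "min 1 (s / u) = 1" by linarith+
      then have "min 1 (s / u) * (u / s) powr \<theta> * ?m powr \<epsilon> = (u / s) powr (\<theta> - \<epsilon>)"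
        using u \<open>0 < s\<close> by (simp add: powr_divide powr_diff)
      also have "\<dots> \<le> (u / s) powr \<epsilon>"
        using \<open>u / s \<le> 1\<close> \<epsilon> u \<open>0 < s\<close> by (intro powr_mono') auto
      also have "\<dots> \<le> ?E powr \<epsilon>"
      proof (intro powr_mono2)
        have "u / s \<le> T / s" using that by (intro divide_right_mono) auto
        moreover have "1 \<le> s / a" using False that by simp
        ultimately show "u / s \<le> ?E" using \<open>u / s \<le> 1\<close> by linarith
      qed (use \<epsilon> u \<open>0 < s\<close> in auto)
      finally show ?thesis .
    qed
    have "min 1 (s / u) * (u powr \<theta> / b u)
        = min 1 (s / u) * (u / s) powr \<theta> * (s powr \<theta> / b s) * (b s / b u)"
      using u \<open>0 < s\<close> pos[of s] by (simp add: powr_divide)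
    also have "\<dots> \<le> min 1 (s / u) * (u / s) powr \<theta> * (s powr \<theta> / b s) * (C * ?m powr \<epsilon>)"
      using u \<open>0 < s\<close> pos[of s] pos[of u] C(2)[of s u]
      by (intro mult_left_mono) (auto simp: pos_divide_le_eq intro!: mult_nonneg_nonneg)
    also have "\<dots> = C * (s powr \<theta> / b s) * (min 1 (s / u) * (u / s) powr \<theta> * ?m powr \<epsilon>)"
      by (simp add: mult_ac)
    also have "\<dots> \<le> C * (s powr \<theta> / b s) * ?E powr \<epsilon>"
      using decay C(1) pos[of s] \<open>0 < s\<close> by (intro mult_left_mono) auto
    finally show ?thesis .
  qed
  with \<epsilon>(1) C(1) show thesis by (rule that)
qed

lemma bdd_above_plateau_summands:
  assumes "slowly_varying b" "0 < \<theta>" "\<theta> < 1" "0 < a" "0 < s"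
  shows "bdd_above ((\<lambda>u. min 1 (s / u) * (u powr \<theta> / b u)) ` {a..T})"
proof -
  obtain \<epsilon> C where "0 < \<epsilon>" "0 < C" and summand: "\<And>a T u s. \<lbrakk>0 < a; a \<le> u; u \<le> T; 0 < s\<rbrakk> \<Longrightarrow>
      min 1 (s / u) * (u powr \<theta> / b u)
        \<le> C * (s powr \<theta> / b s) * min 1 (min (s / a) (T / s)) powr \<epsilon>"
    by (rule plateau_summand_bound[OF assms(1-3)]) (rule that)
  have "min 1 (s / u) * (u powr \<theta> / b u)
      \<le> C * (s powr \<theta> / b s) * min 1 (min (s / a) (T / s)) powr \<epsilon>" if "u \<in> {a..T}" for u
    using that assms(4,5) by (intro summand) auto
  then show ?thesis
    by (rule bdd_aboveI2)
qed

lemma quasi_concave_plateau: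
  assumes "slowly_varying b" "0 < \<theta>" "\<theta> < 1" "0 < a" "a \<le> T"
  shows "quasi_concave (plateau \<theta> b a T)"
proof -
  have "quasi_concave (\<lambda>s. SUP u\<in>{a..T}. (u powr \<theta> / b u) * min 1 (s / u))"
  proof (rule quasi_concave_SUP)
    fix u assume "u \<in> {a..T}"
    then have "0 < u" using assms by auto
    then show "quasi_concave (\<lambda>s. (u powr \<theta> / b u) * min 1 (s / u))"
      using assms(1) by (intro quasi_concave_cmult quasi_concave_min_line) (auto simp: slowly_varying_pos)
  qed (use assms bdd_above_plateau_summands[OF assms(1-4)] in \<open>auto simp: mult.commute\<close>)
  then show ?thesis
    by (simp add: plateau_def[abs_def] mult.commute)
qed

lemma plateau_ge:
  assumes "slowly_varying b" "0 < \<theta>" "\<theta> < 1" "0 < a" "a \<le> s" "s \<le> T"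
  shows "s powr \<theta> / b s \<le> plateau \<theta> b a T s"
proof -
  have "0 < s" "s \<in> {a..T}" using assms(4-6) by simp_all
  have "min 1 (s / s) * (s powr \<theta> / b s)
      \<le> (SUP u\<in>{a..T}. min 1 (s / u) * (u powr \<theta> / b u))"
    using \<open>s \<in> {a..T}\<close> bdd_above_plateau_summands[OF assms(1-4) \<open>0 < s\<close>] by (rule cSUP_upper)
  then show ?thesis using \<open>0 < s\<close> by (simp add: plateau_def)
qed

text \<open>One constant serves for both bounds. The pointwise bound keeps countable suprema of plateaus
  finite; the norm bound says that the plateau has norm at most of order \<open>ln (T / a)\<close> to the power \<open>1 / q\<close>
  in the space whose weight it is made for.\<close>

lemma plateau_bounds:
  assumes b: "slowly_varying b" and \<theta>: "0 < \<theta>" "\<theta> < 1" and q: "0 < q"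
  obtains C where "0 < C"
    and "\<And>a T s. 0 < a \<Longrightarrow> a \<le> T \<Longrightarrow> 0 < s \<Longrightarrow> plateau \<theta> b a T s \<le> C * (s powr \<theta> / b s)"
    and "\<And>a T. 0 < a \<Longrightarrow> exp 1 * a \<le> T \<Longrightarrow>
      weighted_norm \<theta> q b {0<..} (\<lambda>s. ennreal (plateau \<theta> b a T s))
        \<le> ennreal (C * ln (T / a) powr enn2real (1 / q))"
proof -
  note pos = slowly_varying_pos[OF b]
  obtain \<epsilon> C where C: "0 < \<epsilon>" "0 < C"
    and summand: "\<And>a T u s. \<lbrakk>0 < a; a \<le> u; u \<le> T; 0 < s\<rbrakk> \<Longrightarrow>
      min 1 (s / u) * (u powr \<theta> / b u)
        \<le> C * (s powr \<theta> / b s) * min 1 (min (s / a) (T / s)) powr \<epsilon>"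
    by (rule plateau_summand_bound[OF b \<theta>]) (rule that)
  have upper: "plateau \<theta> b a T s \<le> C * (s powr \<theta> / b s) * min 1 (min (s / a) (T / s)) powr \<epsilon>"
    if "0 < a" "a \<le> T" "0 < s" for a T s
    unfolding plateau_def using that by (intro cSUP_least summand) auto
  show thesis
  proof (rule Lq_norm_upper_bound_plateau[OF q C(1)])
    fix D assume D: "0 < D"
      "\<And>a T C g. \<lbrakk>0 < a; exp 1 * a \<le> T; 0 < C; g \<in> borel_measurable (lebesgue_on {0<..});
           \<And>s. 0 < s \<Longrightarrow>
             g s \<le> ennreal (C * (min 1 (min (s / a) (T / s)) powr \<epsilon> * s powr - enn2real (1 / q)))\<rbrakk>
         \<Longrightarrow> Lq_norm q {0<..} g \<le> ennreal (C * D * ln (T / a) powr enn2real (1 / q))"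
  show thesis
  proof (rule that[of "max C (C * D)"])
    show "0 < max C (C * D)" using C by (simp add: less_max_iff_disj)
  next
    fix a T s :: real assume *: "0 < a" "a \<le> T" "0 < s"
    have "min 1 (min (s / a) (T / s)) powr \<epsilon> \<le> 1 powr \<epsilon>"
      using * C by (intro powr_mono2) auto
    then have "C * (s powr \<theta> / b s) * min 1 (min (s / a) (T / s)) powr \<epsilon> \<le> C * (s powr \<theta> / b s) * 1"
      using * C pos[of s] by (intro mult_left_mono) auto
    also have "\<dots> \<le> max C (C * D) * (s powr \<theta> / b s)"
      using pos[of s] * by (simp add: divide_right_mono mult_right_mono)
    finally show "plateau \<theta> b a T s \<le> max C (C * D) * (s powr \<theta> / b s)"
      using upper[OF *] by linarith
  next
    fix a T :: real assume *: "0 < a" "exp 1 * a \<le> T"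
    have "1 * a \<le> exp 1 * a" using \<open>0 < a\<close> by (intro mult_right_mono) auto
    then have "a \<le> T" using * by linarith
    let ?p = "enn2real (1 / q)"
    let ?W = "\<lambda>s. s powr (- \<theta> - ?p) * b s"
    have "weighted_norm \<theta> q b {0<..} (\<lambda>s. ennreal (plateau \<theta> b a T s))
        \<le> ennreal (C * D * ln (T / a) powr ?p)"
      unfolding weighted_norm_def
    proof (rule D(2)[OF * C(2)])
      have "b \<in> borel_measurable (lebesgue_on {0<..})"
        using b by (rule slowly_varying_measurable) simp
      moreover have "(\<lambda>s::real. s powr (- \<theta> - ?p)) \<in> borel_measurable (lebesgue_on {0<..})"
        by (intro measurable_restrict_space1 measurable_completion) measurable
      moreover have "plateau \<theta> b a T \<in> borel_measurable (lebesgue_on {0<..})"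
        using quasi_concave_plateau[OF b \<theta> *(1) \<open>a \<le> T\<close>] by (rule quasi_concave_measurable) auto
      ultimately show "(\<lambda>s. ennreal (?W s) * ennreal (plateau \<theta> b a T s))
          \<in> borel_measurable (lebesgue_on {0<..})"
        by measurable
    next
      fix s :: real assume "0 < s"
      let ?E = "min 1 (min (s / a) (T / s)) powr \<epsilon>"
      have "?W s * plateau \<theta> b a T s \<le> ?W s * (C * (s powr \<theta> / b s) * ?E)"
        using upper[OF *(1) \<open>a \<le> T\<close> \<open>0 < s\<close>] pos[OF \<open>0 < s\<close>] by (intro mult_left_mono) auto
      also have "\<dots> = C * (?E * s powr - ?p)"
        using pos[OF \<open>0 < s\<close>] \<open>0 < s\<close> by (simp add: powr_diff powr_minus field_simps)
      finally have "?W s * plateau \<theta> b a T s \<le> C * (?E * s powr - ?p)" .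
      then show "ennreal (?W s) * ennreal (plateau \<theta> b a T s) \<le> ennreal (C * (?E * s powr - ?p))"
        using pos[OF \<open>0 < s\<close>] by (subst ennreal_mult'[symmetric]) (auto intro: ennreal_leI)
    qed
    also have "\<dots> \<le> ennreal (max C (C * D) * ln (T / a) powr ?p)"
      by (intro ennreal_leI mult_right_mono) auto
    finally show "weighted_norm \<theta> q b {0<..} (\<lambda>s. ennreal (plateau \<theta> b a T s))
        \<le> ennreal (max C (C * D) * ln (T / a) powr ?p)" .
  qed
qed
qed

text \<open>In a space with another exponent and another weight, the same plateau is measured by the
  logarithm to the other power, times a lower bound for the ratio of the weights on \<open>(a, T)\<close>.\<close>

lemma plateau_norm_lower_bound:
  assumes b: "slowly_varying b" and b': "slowly_varying b'" and \<theta>: "0 < \<theta>" "\<theta> < 1"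
    and q: "0 < q" and a: "0 < a" "exp 1 * a \<le> T"
    and S: "{a<..<T} \<subseteq> S" "S \<in> sets lebesgue" and m: "0 \<le> m"
    and le: "\<And>s. a < s \<Longrightarrow> s < T \<Longrightarrow> m \<le> b' s / b s"
  shows "ennreal (m * ln (T / a) powr enn2real (1 / q))
       \<le> weighted_norm \<theta> q b' S (\<lambda>s. ennreal (plateau \<theta> b a T s))"
  unfolding weighted_norm_def
proof (rule Lq_norm_lower_bound_log[OF q a S m])
  fix s assume s: "a < s" "s < T"
  have "0 < s" using s a by linarith
  let ?p = "enn2real (1 / q)"
  let ?W = "s powr (- \<theta> - ?p) * b' s"
  note pos = slowly_varying_pos[OF b \<open>0 < s\<close>] slowly_varying_pos[OF b' \<open>0 < s\<close>]
  have "m * s powr - ?p \<le> b' s / b s * s powr - ?p"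
    using le[OF s] by (intro mult_right_mono) auto
  also have "\<dots> = ?W * (s powr \<theta> / b s)"
    using pos \<open>0 < s\<close> by (simp add: powr_diff powr_minus field_simps)
  also have "\<dots> \<le> ?W * plateau \<theta> b a T s"
    using plateau_ge[OF b \<theta> a(1), of s T] s pos by (intro mult_left_mono) auto
  finally show "ennreal (m * s powr - ?p) \<le> ennreal ?W * ennreal (plateau \<theta> b a T s)"
    using pos by (subst ennreal_mult'[symmetric]) (auto intro: ennreal_leI)
qed

section \<open>A uniform boundedness principle\<close>

text \<open>For finite \<open>q\<close> the \<open>q\<close>-th power of a supremum is at most the sum of the \<open>q\<close>-th powers, whose
  integrals form a geometric series. Working with a supremum rather than a sum makes the argument
  independent of whether \<open>q \<ge> 1\<close>.\<close>

lemma weighted_norm_SUP_finite: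
  assumes q: "0 < q" and b: "slowly_varying b" and "0 \<le> D"
    and qc: "\<And>j. quasi_concave (\<phi> j)"
    and bdd: "\<And>s. 0 < s \<Longrightarrow> bdd_above (range (\<lambda>j. \<phi> j s))"
    and norm: "\<And>j. weighted_norm \<theta> q b {0<..} (\<lambda>s. ennreal (\<phi> j s)) \<le> ennreal (D * (1 / 2) ^ j)"
  shows "weighted_norm \<theta> q b {0<..} (\<lambda>s. ennreal (SUP j. \<phi> j s)) < \<infinity>"
proof -
  let ?W = "\<lambda>s. s powr (- \<theta> - enn2real (1 / q)) * b s"
  let ?\<psi> = "\<lambda>s. SUP j. \<phi> j s"
  have W: "0 < ?W s" if "0 < s" for s
    using slowly_varying_pos[OF b that] that by simp
  have W_meas: "?W \<in> borel_measurable (lebesgue_on {0<..})"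
  proof -
    have "(\<lambda>s::real. s powr (- \<theta> - enn2real (1 / q))) \<in> borel_measurable (lebesgue_on {0<..})"
      by (intro measurable_restrict_space1 measurable_completion) measurable
    then show ?thesis
      using slowly_varying_measurable[OF b order_refl] by (rule borel_measurable_times)
  qed
  have meas: "(\<lambda>s. ennreal (?W s) * ennreal (\<phi> s)) \<in> borel_measurable (lebesgue_on {0<..})"
    if "quasi_concave \<phi>" for \<phi>
    using quasi_concave_measurable[OF that, of "{0<..}"] W_meas by measurable
  have \<psi>: "quasi_concave ?\<psi>"
    by (rule quasi_concave_SUP) (use qc bdd in auto)
  have \<phi>_pos: "0 < \<phi> j s" if "0 < s" for j s
    using qc that by (rule quasi_concave_pos)
  have SUP_le: "?W s * ?\<psi> s \<le> x" if "\<And>j. ?W s * \<phi> j s \<le> x" "0 < s" for s x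
  proof -
    have "?\<psi> s \<le> x / ?W s"
      using that(1) W[OF that(2)] by (intro cSUP_least) (auto simp: pos_le_divide_eq mult.commute)
    then show ?thesis
      using W[OF that(2)] by (simp add: pos_le_divide_eq mult.commute)
  qed
  show ?thesis
    using q
  proof (cases q rule: exponent_cases)
    case infinite
    have "AE s in lebesgue_on {0<..}. \<forall>j. ennreal (?W s) * ennreal (\<phi> j s) \<le> ennreal D"
      unfolding AE_all_countable
    proof
      fix j
      have "esssup (lebesgue_on {0<..}) (\<lambda>s. ennreal (?W s) * ennreal (\<phi> j s)) \<le> ennreal (D * (1 / 2) ^ j)"
        using norm[of j] infinite by (simp add: weighted_norm_def Lq_norm_top)
      also have "\<dots> \<le> ennreal (D * 1)"
        using \<open>0 \<le> D\<close> by (intro ennreal_leI mult_left_mono) (auto intro: power_le_one)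
      finally have "esssup (lebesgue_on {0<..}) (\<lambda>s. ennreal (?W s) * ennreal (\<phi> j s)) \<le> ennreal D"
        by simp
      then show "AE s in lebesgue_on {0<..}. ennreal (?W s) * ennreal (\<phi> j s) \<le> ennreal D"
        by (intro eventually_mono[OF esssup_AE]) (rule order_trans)
    qed
    moreover have "AE s in lebesgue_on {0<..}. s \<in> {0<..}"
      by (rule AE_I2) simp
    ultimately have "AE s in lebesgue_on {0<..}. ennreal (?W s) * ennreal (?\<psi> s) \<le> ennreal D"
    proof eventually_elim
      case (elim s)
      then have "0 < s" by simp
      have "?W s * ?\<psi> s \<le> D"
      proof (rule SUP_le[OF _ \<open>0 < s\<close>])
        fix j
        have "ennreal (?W s * \<phi> j s) \<le> ennreal D"
          using elim(1) W[OF \<open>0 < s\<close>] by (subst ennreal_mult') auto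
        then show "?W s * \<phi> j s \<le> D"
          using \<open>0 \<le> D\<close> by (simp add: ennreal_le_iff)
      qed
      then show ?case
        using W[OF \<open>0 < s\<close>] by (subst ennreal_mult'[symmetric]) (auto intro: ennreal_leI)
    qed
    then have "esssup (lebesgue_on {0<..}) (\<lambda>s. ennreal (?W s) * ennreal (?\<psi> s)) \<le> ennreal D"
      by (intro esssup_I meas[OF \<psi>])
    then show ?thesis
      using infinite(1) by (simp add: weighted_norm_def Lq_norm_top le_less_trans)
  next
    case (finite r)
    let ?I = "\<lambda>j. \<integral>\<^sup>+ s. ennreal_powr (ennreal (?W s) * ennreal (\<phi> j s)) r \<partial>lebesgue_on {0<..}"
    have I_le: "?I j \<le> ennreal (D powr r * ((1 / 2) powr r) ^ j)" for j
    proof -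
      have "ennreal_powr (ennreal_powr (?I j) (1 / r)) r \<le> ennreal_powr (ennreal (D * (1 / 2) ^ j)) r"
        using norm[of j] finite by (intro ennreal_powr_mono) (simp_all add: weighted_norm_def Lq_norm_finite)
      also have "\<dots> = ennreal (D powr r * ((1 / 2) powr r) ^ j)"
      proof -
        have "((1 / 2) ^ j) powr r = (((1 / 2) powr r) ^ j :: real)"
          by (simp add: powr_powr mult.commute flip: powr_realpow)
        then show ?thesis
          using \<open>0 \<le> D\<close> by (simp add: ennreal_powr_ennreal powr_mult)
      qed
      finally show ?thesis
        using ennreal_powr_powr_inverse[of "1 / r" "?I j"] finite by simp
    qed
    have ratio: "(1 / 2) powr r < (1::real)"
      using powr_less_mono2[of r "1 / 2" 1] finite by simp
    then have summable: "summable (\<lambda>j. D powr r * ((1 / 2) powr r) ^ j)"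
      by (intro summable_mult summable_geometric) simp
    have "(\<integral>\<^sup>+ s. ennreal_powr (ennreal (?W s) * ennreal (?\<psi> s)) r \<partial>lebesgue_on {0<..})
        \<le> (\<integral>\<^sup>+ s. (\<Sum>j. ennreal_powr (ennreal (?W s) * ennreal (\<phi> j s)) r) \<partial>lebesgue_on {0<..})"
    proof (rule nn_integral_mono)
      fix s assume "s \<in> space (lebesgue_on {0::real<..})"
      then have "0 < s" by simp
      have eq: "ennreal_powr (ennreal (?W s) * ennreal x) r = ennreal ((?W s * x) powr r)"
        if "0 \<le> x" for x
        using W[OF \<open>0 < s\<close>] that
        by (subst ennreal_mult[symmetric]) (auto intro!: ennreal_powr_ennreal)
      let ?S = "\<Sum>j. ennreal_powr (ennreal (?W s) * ennreal (\<phi> j s)) r"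
      show "ennreal_powr (ennreal (?W s) * ennreal (?\<psi> s)) r \<le> ?S"
      proof (cases ?S)
        case (real x)
        have "?W s * ?\<psi> s \<le> x powr (1 / r)"
        proof (rule SUP_le[OF _ \<open>0 < s\<close>])
          fix j
          have "ennreal ((?W s * \<phi> j s) powr r) \<le> ?S"
            using eq[of "\<phi> j s"] \<phi>_pos[OF \<open>0 < s\<close>, of j]
              ennreal_suminf_lessD[of "\<lambda>j. ennreal_powr (ennreal (?W s) * ennreal (\<phi> j s)) r" _ j]
            by (metis linorder_not_less order.strict_iff_not)
          then have "(?W s * \<phi> j s) powr r \<le> x"
            using real by (simp add: ennreal_le_iff)
          then have "((?W s * \<phi> j s) powr r) powr (1 / r) \<le> x powr (1 / r)"
            using finite by (intro powr_mono2) auto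
          then show "?W s * \<phi> j s \<le> x powr (1 / r)"
            using finite W[OF \<open>0 < s\<close>] \<phi>_pos[OF \<open>0 < s\<close>, of j]
            by (simp only: powr_powr) (simp add: powr_one)
        qed
        then have "(?W s * ?\<psi> s) powr r \<le> (x powr (1 / r)) powr r"
          using W[OF \<open>0 < s\<close>] quasi_concave_pos[OF \<psi> \<open>0 < s\<close>] finite
          by (intro powr_mono2) (auto intro: mult_nonneg_nonneg less_imp_le)
        also have "\<dots> = x"
          using real finite by (simp add: powr_powr)
        finally show ?thesis
          using real eq[of "?\<psi> s"] quasi_concave_pos[OF \<psi> \<open>0 < s\<close>] by (simp add: ennreal_leI)
      qed simp
    qed
    also have "\<dots> = (\<Sum>j. ?I j)"
      by (intro nn_integral_suminf measurable_ennreal_powr meas qc)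
    also have "\<dots> \<le> (\<Sum>j. ennreal (D powr r * ((1 / 2) powr r) ^ j))"
      by (intro suminf_le I_le) auto
    also have "\<dots> = ennreal (\<Sum>j. D powr r * ((1 / 2) powr r) ^ j)"
      using summable by (intro suminf_ennreal2) auto
    finally have "Lq_norm q {0<..} (\<lambda>s. ennreal (?W s) * ennreal (?\<psi> s))
        \<le> ennreal_powr (ennreal (\<Sum>j. D powr r * ((1 / 2) powr r) ^ j)) (1 / r)"
      using finite by (simp add: Lq_norm_finite ennreal_powr_mono)
    also have "\<dots> < \<infinity>"
      by (simp add: ennreal_powr_def)
    finally show ?thesis
      by (simp add: weighted_norm_def)
  qed
qed

text \<open>A gliding hump. If no uniform constant existed, functions \<open>\<phi> j \<in> \<Phi>\<close> would violate the bound
  \<open>4 ^ j\<close>; the supremum of the \<open>(1 / 2) ^ j * \<phi> j\<close> is one quasi-concave function of finite norm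
  on which the functionals \<open>N i\<close> exceed every \<open>2 ^ j\<close>, against the assumed bound for that function.
  It serves to remove the dependence on the function: the constants in the definition of \<open>K\<close>-surjectivity vary
  with the quasi-concave function.\<close>

lemma uniform_boundedness_quasi_concave:
  fixes N :: "'i \<Rightarrow> (real \<Rightarrow> real) \<Rightarrow> ennreal"
  assumes q: "0 < q" and b: "slowly_varying b"
    and qc: "\<And>\<phi>. \<phi> \<in> \<Phi> \<Longrightarrow> quasi_concave \<phi>"
    and pointwise: "\<And>\<phi> s. \<phi> \<in> \<Phi> \<Longrightarrow> 0 < s \<Longrightarrow> \<phi> s \<le> B s"
    and "0 \<le> D"
    and norm: "\<And>\<phi>. \<phi> \<in> \<Phi> \<Longrightarrow> weighted_norm \<theta> q b {0<..} (\<lambda>s. ennreal (\<phi> s)) \<le> ennreal D"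
    and mono: "\<And>i \<phi> \<psi> c. \<lbrakk>i \<in> I; quasi_concave \<phi>; quasi_concave \<psi>; 0 < c; \<And>s. 0 < s \<Longrightarrow> c * \<phi> s \<le> \<psi> s\<rbrakk>
      \<Longrightarrow> ennreal c * N i \<phi> \<le> N i \<psi>"
    and bounded: "\<And>\<phi>. \<lbrakk>quasi_concave \<phi>; weighted_norm \<theta> q b {0<..} (\<lambda>s. ennreal (\<phi> s)) < \<infinity>\<rbrakk>
      \<Longrightarrow> \<exists>c::real. \<forall>i\<in>I. N i \<phi> \<le> ennreal c"
  shows "\<exists>C::real. \<forall>i\<in>I. \<forall>\<phi>\<in>\<Phi>. N i \<phi> \<le> ennreal C"
proof (rule ccontr)
  assume "\<not> ?thesis"
  then have "\<forall>C::real. \<exists>i\<in>I. \<exists>\<phi>\<in>\<Phi>. ennreal C < N i \<phi>"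
    by (simp add: not_le)
  then have "\<forall>j. \<exists>i\<in>I. \<exists>\<phi>\<in>\<Phi>. ennreal (4 ^ j) < N i \<phi>"
    by blast
  then obtain i \<phi> where i: "\<And>j. i j \<in> I" and \<phi>: "\<And>j. \<phi> j \<in> \<Phi>"
    and big: "\<And>j. ennreal (4 ^ j) < N (i j) (\<phi> j)"
    by metis
  define \<phi>' where "\<phi>' j s = (1 / 2) ^ j * \<phi> j s" for j s
  define \<psi> where "\<psi> s = (SUP j. \<phi>' j s)" for s
  have qc': "quasi_concave (\<phi>' j)" for j
    unfolding \<phi>'_def[abs_def] by (rule quasi_concave_cmult[OF qc[OF \<phi>]]) simp
  have bdd: "bdd_above (range (\<lambda>j. \<phi>' j s))" if "0 < s" for s
  proof (rule bdd_aboveI2)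
    fix j
    have "0 < \<phi> j s" using qc[OF \<phi>] that by (rule quasi_concave_pos)
    then have "\<phi>' j s \<le> 1 * \<phi> j s"
      unfolding \<phi>'_def by (intro mult_right_mono power_le_one) auto
    also have "\<dots> \<le> B s" using pointwise[OF \<phi> that] by simp
    finally show "\<phi>' j s \<le> B s" .
  qed
  have norm': "weighted_norm \<theta> q b {0<..} (\<lambda>s. ennreal (\<phi>' j s)) \<le> ennreal (D * (1 / 2) ^ j)" for j
  proof -
    let ?n = "weighted_norm \<theta> q b {0<..} (\<lambda>s. ennreal (\<phi>' j s))"
    have "ennreal (2 ^ j) * ?n \<le> weighted_norm \<theta> q b {0<..} (\<lambda>s. ennreal (\<phi> j s))"
    proof (rule weighted_norm_mono[OF q b])
      show "(\<lambda>s. ennreal (\<phi>' j s)) \<in> borel_measurable (lebesgue_on {0<..})"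
        using quasi_concave_measurable[OF qc', of "{0<..}" j] by measurable
      show "ennreal (2 ^ j) * ennreal (\<phi>' j s) \<le> ennreal (\<phi> j s)" for s
        by (subst ennreal_mult'[symmetric]) (simp_all add: \<phi>'_def power_one_over)
    qed auto
    also have "\<dots> \<le> ennreal D" by (rule norm[OF \<phi>])
    finally have "ennreal ((1 / 2) ^ j) * (ennreal (2 ^ j) * ?n) \<le> ennreal ((1 / 2) ^ j) * ennreal D"
      by (rule mult_left_mono) simp
    moreover have "ennreal ((1 / 2) ^ j) * (ennreal (2 ^ j) * ?n) = ?n"
      by (simp add: mult.assoc[symmetric] ennreal_mult[symmetric] power_one_over)
    ultimately show ?thesis
      using \<open>0 \<le> D\<close> by (simp add: ennreal_mult[symmetric] mult.commute)
  qed
  have \<psi>_qc: "quasi_concave \<psi>"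
    unfolding \<psi>_def[abs_def] by (rule quasi_concave_SUP) (use qc' bdd in auto)
  moreover have "weighted_norm \<theta> q b {0<..} (\<lambda>s. ennreal (\<psi> s)) < \<infinity>"
    unfolding \<psi>_def using q b \<open>0 \<le> D\<close> qc' bdd norm' by (rule weighted_norm_SUP_finite)
  ultimately obtain c :: real where c: "\<And>i. i \<in> I \<Longrightarrow> N i \<psi> \<le> ennreal c"
    using bounded by blast
  obtain n where n: "c < 2 ^ n"
    using real_arch_pow[of 2 c] by auto
  have "ennreal ((1 / 2) ^ n) * N (i n) (\<phi> n) \<le> N (i n) \<psi>"
  proof (rule mono[OF i qc[OF \<phi>] \<psi>_qc])
    fix s :: real assume "0 < s"
    have "\<phi>' n s \<le> \<psi> s"
      unfolding \<psi>_def using bdd[OF \<open>0 < s\<close>] by (intro cSUP_upper) auto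
    then show "(1 / 2) ^ n * \<phi> n s \<le> \<psi> s" by (simp add: \<phi>'_def)
  qed simp
  also have "\<dots> \<le> ennreal c" by (rule c[OF i])
  finally have "ennreal ((1 / 2) ^ n) * ennreal (4 ^ n) \<le> ennreal c"
    using big[of n] by (meson less_imp_le mult_left_mono order_trans zero_le)
  then have "ennreal (2 ^ n) \<le> ennreal c"
    by (simp add: ennreal_mult[symmetric] power_mult_distrib[symmetric])
  moreover have "ennreal c < ennreal (2 ^ n)"
    using n by (intro ennreal_lessI) simp_all
  ultimately show False by simp
qed

text \<open>The uniform boundedness principle for the family of all plateaus, scaled to bounded norm.\<close>

lemma uniform_bound_plateau:
  fixes N :: "'i \<Rightarrow> (real \<Rightarrow> real) \<Rightarrow> ennreal"
  assumes q: "0 < q" and b: "slowly_varying b" and \<theta>: "0 < \<theta>" "\<theta> < 1"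
    and mono: "\<And>i \<phi> \<psi> c. \<lbrakk>i \<in> I; quasi_concave \<phi>; quasi_concave \<psi>; 0 < c; \<And>s. 0 < s \<Longrightarrow> c * \<phi> s \<le> \<psi> s\<rbrakk>
      \<Longrightarrow> ennreal c * N i \<phi> \<le> N i \<psi>"
    and bounded: "\<And>\<phi>. \<lbrakk>quasi_concave \<phi>; weighted_norm \<theta> q b {0<..} (\<lambda>s. ennreal (\<phi> s)) < \<infinity>\<rbrakk>
      \<Longrightarrow> \<exists>c::real. \<forall>i\<in>I. N i \<phi> \<le> ennreal c"
  obtains C where "0 < C"
    and "\<And>i a T. \<lbrakk>i \<in> I; 0 < a; exp 1 * a \<le> T\<rbrakk> \<Longrightarrow>
      N i (plateau \<theta> b a T) \<le> ennreal (C * ln (T / a) powr enn2real (1 / q))"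
proof (rule plateau_bounds[OF b \<theta> q])
  let ?p = "enn2real (1 / q)"
  fix D assume "0 < D"
    and pointwise: "\<And>a T s. 0 < a \<Longrightarrow> a \<le> T \<Longrightarrow> 0 < s \<Longrightarrow> plateau \<theta> b a T s \<le> D * (s powr \<theta> / b s)"
    and norm: "\<And>a T. 0 < a \<Longrightarrow> exp 1 * a \<le> T \<Longrightarrow>
      weighted_norm \<theta> q b {0<..} (\<lambda>s. ennreal (plateau \<theta> b a T s)) \<le> ennreal (D * ln (T / a) powr ?p)"
  define f where "f a T s = 1 / ln (T / a) powr ?p * plateau \<theta> b a T s" for a T s
  define \<Phi> where "\<Phi> = {f a T | a T. 0 < a \<and> exp 1 * a \<le> T}"
  have aT: "a \<le> T" "1 \<le> ln (T / a) powr ?p" if "0 < a" "exp 1 * a \<le> T" for a T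
  proof -
    have "1 * a \<le> exp 1 * a" using \<open>0 < a\<close> by (intro mult_right_mono) auto
    then show "a \<le> T" using that by linarith
    show "1 \<le> ln (T / a) powr ?p" using one_le_ln_ratio[OF that] by (intro ge_one_powr_ge_zero) auto
  qed
  have plateau_qc: "quasi_concave (plateau \<theta> b a T)" if "0 < a" "exp 1 * a \<le> T" for a T
    by (rule quasi_concave_plateau[OF b \<theta> that(1) aT(1)[OF that]])
  have f_qc: "quasi_concave (f a T)" if "0 < a" "exp 1 * a \<le> T" for a T
    unfolding f_def[abs_def] using aT(2)[OF that]
    by (intro quasi_concave_cmult plateau_qc[OF that]) auto
  have "\<exists>C::real. \<forall>i\<in>I. \<forall>\<phi>\<in>\<Phi>. N i \<phi> \<le> ennreal C"
  proof (rule uniform_boundedness_quasi_concave[OF q b, where D = D and \<theta> = \<theta>])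
    show "quasi_concave \<phi>" if "\<phi> \<in> \<Phi>" for \<phi>
      using that f_qc by (auto simp: \<Phi>_def)
    show "\<phi> s \<le> D * (s powr \<theta> / b s)" if "\<phi> \<in> \<Phi>" "0 < s" for \<phi> s
    proof -
      obtain a T where *: "\<phi> = f a T" "0 < a" "exp 1 * a \<le> T"
        using \<open>\<phi> \<in> \<Phi>\<close> by (auto simp: \<Phi>_def)
      have "f a T s \<le> 1 * plateau \<theta> b a T s"
        unfolding f_def using aT[OF *(2,3)] quasi_concave_pos[OF plateau_qc[OF *(2,3)] \<open>0 < s\<close>]
        by (intro mult_right_mono) (auto simp: divide_le_eq)
      also have "\<dots> \<le> D * (s powr \<theta> / b s)"
        using pointwise[OF *(2) aT(1)[OF *(2,3)] \<open>0 < s\<close>] by simp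
      finally show ?thesis using *(1) by simp
    qed
    show "weighted_norm \<theta> q b {0<..} (\<lambda>s. ennreal (\<phi> s)) \<le> ennreal D" if "\<phi> \<in> \<Phi>" for \<phi>
    proof -
      obtain a T where *: "\<phi> = f a T" "0 < a" "exp 1 * a \<le> T"
        using \<open>\<phi> \<in> \<Phi>\<close> by (auto simp: \<Phi>_def)
      let ?L = "ln (T / a) powr ?p"
      have L: "0 < ?L" using aT(2)[OF *(2,3)] by linarith
      have "ennreal ?L * weighted_norm \<theta> q b {0<..} (\<lambda>s. ennreal (\<phi> s))
          \<le> weighted_norm \<theta> q b {0<..} (\<lambda>s. ennreal (plateau \<theta> b a T s))"
      proof (rule weighted_norm_mono[OF q b])
        show "(\<lambda>s. ennreal (\<phi> s)) \<in> borel_measurable (lebesgue_on {0<..})"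
          using quasi_concave_measurable[OF f_qc[OF *(2,3)], of "{0<..}"] *(1) by simp
        show "ennreal ?L * ennreal (\<phi> s) \<le> ennreal (plateau \<theta> b a T s)" for s
          using L by (subst ennreal_mult'[symmetric]) (simp_all add: *(1) f_def)
      qed (use L in auto)
      also have "\<dots> \<le> ennreal (D * ?L)" by (rule norm[OF *(2,3)])
      finally have "ennreal (1 / ?L) * (ennreal ?L * weighted_norm \<theta> q b {0<..} (\<lambda>s. ennreal (\<phi> s)))
          \<le> ennreal (1 / ?L) * ennreal (D * ?L)"
        by (rule mult_left_mono) simp
      then show ?thesis
        using L \<open>0 < D\<close> by (simp add: mult.assoc[symmetric] ennreal_mult[symmetric])
    qed
  qed (use \<open>0 < D\<close> mono bounded in auto)
  then obtain C :: real where C: "\<And>i a T. \<lbrakk>i \<in> I; 0 < a; exp 1 * a \<le> T\<rbrakk> \<Longrightarrow> N i (f a T) \<le> ennreal C"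
    unfolding \<Phi>_def by blast
  show thesis
  proof (rule that[of "max C 1"])
    fix i and a T :: real assume *: "i \<in> I" "0 < a" "exp 1 * a \<le> T"
    let ?L = "ln (T / a) powr ?p"
    have L: "0 < ?L" using aT(2)[OF *(2,3)] by linarith
    have "ennreal (1 / ?L) * N i (plateau \<theta> b a T) \<le> N i (f a T)"
      using L by (intro mono[OF *(1) plateau_qc[OF *(2,3)] f_qc[OF *(2,3)]]) (auto simp: f_def)
    also have "\<dots> \<le> ennreal C" by (rule C[OF *])
    also have "\<dots> \<le> ennreal (max C 1)" by (intro ennreal_leI) simp
    finally have "ennreal ?L * (ennreal (1 / ?L) * N i (plateau \<theta> b a T)) \<le> ennreal ?L * ennreal (max C 1)"
      by (rule mult_left_mono) simp
    then show "N i (plateau \<theta> b a T) \<le> ennreal (max C 1 * ?L)"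
      using L by (simp add: mult.assoc[symmetric] ennreal_mult[symmetric] mult.commute[of ?L])
  qed simp
qed

section \<open>Incompatible growth of the weights\<close>

lemma max_ratio_le_exp_one:
  fixes s u :: real
  assumes "0 < s" "0 < u" "s \<le> exp 1 * u" "u \<le> exp 1 * s"
  shows "max (s / u) (u / s) \<le> exp 1"
  using assms by (simp add: pos_divide_le_eq)

text \<open>The inequalities \<open>right\<close> and \<open>left\<close> are what plateaus yield when placed to the right and to
  the left of \<open>t\<close>. Plateaus with \<open>ln (T / a) = 1\<close> show that \<open>w\<close> is comparable to \<open>r\<close> and that
  \<open>r\<close> is non-decreasing up to a constant. Then long plateaus give
  \<open>r a * ln (T / a) powr \<bar>p' - p\<bar> \<le> G * r T\<close>: the inequality \<open>right\<close> does so for \<open>p < p'\<close>, and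
  \<open>left\<close> does so for \<open>p' < p\<close>. Consequently \<open>r\<close> at least doubles whenever its argument is multiplied
  by a suitable constant, so it grows at least like a power, which slow variation forbids.\<close>

lemma weight_gap_contradiction:
  fixes r w :: "real \<Rightarrow> real"
  assumes pos: "\<And>t. 0 < t \<Longrightarrow> 0 < r t" "\<And>t. 0 < t \<Longrightarrow> 0 < w t"
    and slow: "\<And>\<epsilon>. 0 < \<epsilon> \<Longrightarrow>
      \<exists>C>0. \<forall>s u. 0 < s \<longrightarrow> 0 < u \<longrightarrow> r s \<le> C * max (s / u) (u / s) powr \<epsilon> * r u"
    and C: "0 < C"
    and right: "\<And>t a T M. \<lbrakk>0 < t; t \<le> a; exp 1 * a \<le> T; 0 < M; \<And>s. a < s \<Longrightarrow> s < T \<Longrightarrow> r s \<le> M\<rbrakk>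
      \<Longrightarrow> w t * ln (T / a) powr p' \<le> C * M * ln (T / a) powr p"
    and left: "\<And>t a T m. \<lbrakk>0 < a; exp 1 * a \<le> T; T \<le> t; 0 < m; \<And>s. a < s \<Longrightarrow> s < T \<Longrightarrow> m \<le> r s\<rbrakk>
      \<Longrightarrow> m * ln (T / a) powr p \<le> C * w t * ln (T / a) powr p'"
    and "p \<noteq> p'"
  shows False
proof -
  obtain C' where C': "0 < C'"
    "\<And>s u. 0 < s \<Longrightarrow> 0 < u \<Longrightarrow> r s \<le> C' * max (s / u) (u / s) powr 1 * r u"
    using slow[of 1] by auto
  define B where "B = C' * exp 1"
  have B: "0 < B" using C' by (simp add: B_def)
  have close: "r s \<le> B * r u" if "0 < s" "0 < u" "s \<le> exp 1 * u" "u \<le> exp 1 * s" for s u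
  proof -
    have "r s \<le> C' * max (s / u) (u / s) powr 1 * r u" by (intro C'(2) that)
    also have "max (s / u) (u / s) powr 1 = max (s / u) (u / s)"
      using that by (intro powr_one) (simp add: le_max_iff_disj)
    also have "C' * max (s / u) (u / s) * r u \<le> C' * exp 1 * r u"
      using C' pos(1)[OF that(2)] max_ratio_le_exp_one[OF that]
      by (intro mult_right_mono mult_left_mono) auto
    finally show ?thesis by (simp add: B_def)
  qed
  define H where "H = C * B"
  have H: "0 < H" using C B by (simp add: H_def)
  \<comment> \<open>The plateaus on \<open>[u, exp 1 * u]\<close> here and on \<open>[u / exp 1, u]\<close> below have logarithmic length
    \<open>1\<close>, so both powers of the logarithm disappear.\<close>
  have w_le: "w t \<le> H * r u" if "0 < t" "t \<le> u" for t u
  proof -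
    have "0 < u" using that by linarith
    have "r s \<le> B * r u" if "u < s" "s < exp 1 * u" for s
    proof (rule close)
      have "1 * s \<le> exp 1 * s" using that \<open>0 < u\<close> by (intro mult_right_mono) auto
      then show "u \<le> exp 1 * s" using that by linarith
    qed (use that \<open>0 < u\<close> in linarith)+
    then have "w t * ln (exp 1 * u / u) powr p' \<le> C * (B * r u) * ln (exp 1 * u / u) powr p"
      using that \<open>0 < u\<close> B pos(1) by (intro right) auto
    then show ?thesis using \<open>0 < u\<close> by (simp add: H_def mult.assoc)
  qed
  have r_le: "r u \<le> H * w t" if "0 < u" "u \<le> t" for t u
  proof -
    define a where "a = u / exp 1"
    have a: "0 < a" "exp 1 * a = u" using that by (simp_all add: a_def)
    have "r u / B \<le> r s" if "a < s" "s < u" for s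
    proof -
      have "1 * u \<le> exp 1 * u" using \<open>0 < u\<close> by (intro mult_right_mono) auto
      moreover have "exp 1 * a \<le> exp 1 * s" using that by simp
      ultimately have "r u \<le> B * r s"
        using that a \<open>0 < u\<close> by (intro close) linarith+
      then show ?thesis using B by (simp add: pos_divide_le_eq mult.commute)
    qed
    then have "r u / B * ln (u / a) powr p \<le> C * w t * ln (u / a) powr p'"
      using that a B pos(1)[of u] by (intro left) auto
    moreover have "ln (u / a) = 1" using \<open>0 < u\<close> by (simp add: a_def)
    ultimately have "r u / B \<le> C * w t" by simp
    then show ?thesis using B by (simp add: H_def pos_divide_le_eq mult_ac)
  qed
  have almost_mono: "r s \<le> H\<^sup>2 * r u" if "0 < s" "s \<le> u" for s u
  proof -
    have "r s \<le> H * w s" using that by (intro r_le) auto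
    also have "\<dots> \<le> H * (H * r u)" using H w_le[OF that] by simp
    finally show ?thesis by (simp add: power2_eq_square)
  qed
  have ln_pos: "0 < ln (T / a)" if "0 < a" "exp 1 * a \<le> T" for a T :: real
    using one_le_ln_ratio[OF that] by linarith
  define \<delta> where "\<delta> = \<bar>p' - p\<bar>"
  define G where "G = C * H ^ 3"
  have "0 < \<delta>" "0 < G" using \<open>p \<noteq> p'\<close> C H by (auto simp: \<delta>_def G_def)
  have growth: "r a * ln (T / a) powr \<delta> \<le> G * r T" if aT: "0 < a" "exp 1 * a \<le> T" for a T
  proof -
    let ?L = "ln (T / a)"
    note L = ln_pos[OF aT]
    have "0 < exp 1 * a" using aT by simp
    then have "0 < T" using aT by linarith
    have "1 * a \<le> exp 1 * a" using aT by (intro mult_right_mono) auto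
    then have "a \<le> T" using aT by linarith
    show ?thesis
    proof (cases "p < p'")
      case True
      have "w a * ?L powr p' \<le> C * (H\<^sup>2 * r T) * ?L powr p"
      proof (rule right)
        show "r s \<le> H\<^sup>2 * r T" if "a < s" "s < T" for s
          using that aT by (intro almost_mono) auto
      qed (use aT H pos(1)[OF \<open>0 < T\<close>] in auto)
      then have "w a * (?L powr p' / ?L powr p) \<le> C * (H\<^sup>2 * r T)"
        using L by (simp add: pos_divide_le_eq)
      then have "w a * ?L powr \<delta> \<le> C * (H\<^sup>2 * r T)"
        using True by (simp add: \<delta>_def powr_diff)
      then have "H * (w a * ?L powr \<delta>) \<le> H * (C * (H\<^sup>2 * r T))"
        using H by (intro mult_left_mono) auto
      moreover have "r a * ?L powr \<delta> \<le> H * w a * ?L powr \<delta>"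
        using aT by (intro mult_right_mono r_le) auto
      ultimately show ?thesis
        by (simp add: G_def power2_eq_square power3_eq_cube mult_ac)
    next
      case False
      have "r a / H\<^sup>2 * ?L powr p \<le> C * w T * ?L powr p'"
      proof (rule left)
        show "r a / H\<^sup>2 \<le> r s" if "a < s" "s < T" for s
          using almost_mono[of a s] that aT H by (simp add: pos_divide_le_eq mult.commute)
      qed (use aT H pos(1)[OF \<open>0 < a\<close>] in auto)
      then have "r a / H\<^sup>2 * ?L powr p / ?L powr p' \<le> C * w T"
        using L by (subst pos_divide_le_eq) auto
      also have "\<dots> \<le> C * (H * r T)"
        using C \<open>0 < T\<close> by (intro mult_left_mono w_le) auto
      finally have "r a / H\<^sup>2 * ?L powr \<delta> \<le> C * (H * r T)"
        using False by (simp add: \<delta>_def powr_diff)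
      then have "r a * ?L powr \<delta> \<le> C * (H * r T) * H\<^sup>2"
        using H by (simp add: pos_divide_le_eq)
      then show ?thesis
        by (simp add: G_def power2_eq_square power3_eq_cube mult_ac)
    qed
  qed
  \<comment> \<open>Chosen so that \<open>l powr \<delta> \<ge> 2 * G\<close>: over the ratio \<open>exp l\<close> the function \<open>r\<close> doubles.\<close>
  define l where "l = max 1 ((2 * G) powr (1 / \<delta>))"
  have l: "1 \<le> l" by (simp add: l_def)
  have "2 * G = ((2 * G) powr (1 / \<delta>)) powr \<delta>"
    using \<open>0 < G\<close> \<open>0 < \<delta>\<close> by (simp add: powr_powr)
  also have "\<dots> \<le> l powr \<delta>"
    using \<open>0 < \<delta>\<close> by (intro powr_mono2) (auto simp: l_def)
  finally have l_powr: "2 * G \<le> l powr \<delta>" .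
  have step: "2 * r a \<le> r (exp l * a)" if "0 < a" for a
  proof -
    have "r a * ln (exp l * a / a) powr \<delta> \<le> G * r (exp l * a)"
      using that l by (intro growth) auto
    then have "r a * l powr \<delta> \<le> G * r (exp l * a)" using that by simp
    moreover have "r a * (2 * G) \<le> r a * l powr \<delta>"
      using l_powr pos(1)[OF that] by (intro mult_left_mono) auto
    ultimately have "G * (2 * r a) \<le> G * r (exp l * a)" by (simp add: mult_ac)
    then show ?thesis using \<open>0 < G\<close> by simp
  qed
  have power_growth: "2 ^ n * r 1 \<le> r (exp l ^ n)" for n
  proof (induction n)
    case (Suc n)
    have "2 ^ Suc n * r 1 \<le> 2 * r (exp l ^ n)" using Suc by simp
    also have "\<dots> \<le> r (exp l * exp l ^ n)" by (rule step) simp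
    finally show ?case by simp
  qed simp
  \<comment> \<open>With this exponent, slow variation allows growth only by the factor \<open>3 / 2 < 2\<close> per ratio
    \<open>exp l\<close>.\<close>
  define \<epsilon> where "\<epsilon> = ln (3 / 2) / l"
  have "0 < \<epsilon>" using l by (simp add: \<epsilon>_def)
  then obtain K where K: "0 < K"
    "\<And>s u. 0 < s \<Longrightarrow> 0 < u \<Longrightarrow> r s \<le> K * max (s / u) (u / s) powr \<epsilon> * r u"
    using slow[of \<epsilon>] by auto
  have slow_growth: "r (exp l ^ n) \<le> K * (3 / 2) ^ n * r 1" for n
  proof -
    have "1 \<le> exp l ^ n" using l by (intro one_le_power) simp
    then have "1 / exp l ^ n \<le> 1" by simp
    then have "max (exp l ^ n / 1) (1 / exp l ^ n) = exp l ^ n"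
      using \<open>1 \<le> exp l ^ n\<close> by linarith
    then have "max (exp l ^ n / 1) (1 / exp l ^ n) powr \<epsilon> = (exp l ^ n) powr \<epsilon>"
      by (rule arg_cong)
    also have "\<dots> = exp (real n * ln (3 / 2))"
      using l by (simp add: powr_def ln_realpow \<epsilon>_def)
    also have "\<dots> = (3 / 2) ^ n"
      by (simp add: exp_of_nat_mult)
    finally show ?thesis using K(2)[of "exp l ^ n" 1] by simp
  qed
  obtain n where n: "K < (4 / 3) ^ n"
    using real_arch_pow[of "4 / 3" K] by auto
  have "2 ^ n * r 1 \<le> K * (3 / 2) ^ n * r 1"
    using power_growth[of n] slow_growth[of n] by linarith
  then have "2 ^ n \<le> K * (3 / 2) ^ n" using pos(1)[of 1] by simp
  moreover have "K * (3 / 2) ^ n < (4 / 3) ^ n * (3 / 2) ^ n"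
    using n by (intro mult_strict_right_mono) auto
  moreover have "(4 / 3) ^ n * (3 / 2) ^ n = (2::real) ^ n"
    by (simp add: power_mult_distrib[symmetric])
  ultimately show False by simp
qed

section \<open>The K-functional\<close>

lemma K_functional_mono:
  assumes "quasi_normed_space A1" "s \<le> t"
  shows "K_functional A0 A1 s f \<le> K_functional A0 A1 t f"
  unfolding K_functional_def
proof (rule Inf_mono)
  fix y
  assume "y \<in> {ennreal (qnorm A0 f0 + t * qnorm A1 f1) | f0 f1.
    f0 \<in> points A0 \<and> f1 \<in> points A1 \<and> f = f0 + f1}"
  then obtain f0 f1 where f: "y = ennreal (qnorm A0 f0 + t * qnorm A1 f1)"
    "f0 \<in> points A0" "f1 \<in> points A1" "f = f0 + f1" by blast
  have "0 \<le> qnorm A1 f1" using assms(1) f(3) by (simp add: quasi_normed_space_def)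
  then have "ennreal (qnorm A0 f0 + s * qnorm A1 f1) \<le> y"
    using assms(2) f(1) by (auto intro!: ennreal_leI mult_right_mono)
  then show "\<exists>x\<in>{ennreal (qnorm A0 f0 + s * qnorm A1 f1) | f0 f1.
      f0 \<in> points A0 \<and> f1 \<in> points A1 \<and> f = f0 + f1}. x \<le> y"
    using f by blast
qed

lemma K_functional_finite: "f \<in> sum_space A0 A1 \<Longrightarrow> K_functional A0 A1 t f < \<infinity>"
  unfolding sum_space_def K_functional_def by (force simp: Inf_less_iff)

lemma K_functional_measurable:
  assumes "quasi_normed_space A1" "f \<in> sum_space A0 A1" "S \<subseteq> {0<..}" "S \<in> sets borel"
  shows "(\<lambda>s. K_functional A0 A1 s f) \<in> borel_measurable (lebesgue_on S)"
proof -
  have "mono_on {0<..} (\<lambda>s. enn2real (K_functional A0 A1 s f))"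
    using K_functional_finite[OF assms(2)]
    by (intro mono_onI enn2real_mono K_functional_mono assms(1)) auto
  then have "(\<lambda>s. enn2real (K_functional A0 A1 s f)) \<in> borel_measurable (lebesgue_on S)"
    using assms(3,4) by (rule mono_on_imp_lebesgue_measurable)
  then have "(\<lambda>s. ennreal (enn2real (K_functional A0 A1 s f))) \<in> borel_measurable (lebesgue_on S)"
    by measurable
  moreover have "ennreal (enn2real (K_functional A0 A1 s f)) = K_functional A0 A1 s f" for s
    using K_functional_finite[OF assms(2)] by simp
  ultimately show ?thesis by (simp only:)
qed

lemma quasi_normed_space_zero:
  assumes "quasi_normed_space A"
  shows "0 \<in> points A" "qnorm A 0 = 0"
proof -
  show "0 \<in> points A"
    using assms unfolding quasi_normed_space_def by (intro subspace_0) (elim conjE)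
  moreover have "\<forall>x\<in>points A. 0 \<le> qnorm A x \<and> (qnorm A x = 0 \<longleftrightarrow> x = 0)"
    using assms unfolding quasi_normed_space_def by (elim conjE)
  ultimately show "qnorm A 0 = 0" by simp
qed

lemma K_functional_zero:
  assumes "quasi_normed_space A0" "quasi_normed_space A1"
  shows "K_functional A0 A1 t 0 = 0"
proof -
  note zero = quasi_normed_space_zero[OF assms(1)] quasi_normed_space_zero[OF assms(2)]
  have "K_functional A0 A1 t 0 \<le> ennreal (qnorm A0 0 + t * qnorm A1 0)"
    unfolding K_functional_def using zero by (intro Inf_lower) force
  then show ?thesis using zero by simp
qed

lemma zero_in_interpolation_space:
  assumes "quasi_normed_space A0" "quasi_normed_space A1" "0 < q"
  shows "0 \<in> points (interpolation_space A0 A1 \<theta> q b)" "qnorm (interpolation_space A0 A1 \<theta> q b) 0 = 0"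
proof -
  have norm: "weighted_K_norm A0 A1 \<theta> q b S 0 = 0" for S
    using assms by (simp add: weighted_K_norm_def K_functional_zero Lq_norm_zero)
  have "0 + 0 \<in> sum_space A0 A1"
    unfolding sum_space_def using assms(1,2)[THEN quasi_normed_space_zero(1)] by blast
  then show "0 \<in> points (interpolation_space A0 A1 \<theta> q b)"
    by (simp add: interpolation_space_def norm)
  show "qnorm (interpolation_space A0 A1 \<theta> q b) 0 = 0"
    by (simp add: interpolation_space_def norm)
qed

text \<open>The trivial decomposition \<open>f = f + 0\<close>.\<close>

lemma K_functional_le_left:
  assumes "quasi_normed_space A0" "quasi_normed_space A1" "0 < q1" "f \<in> sum_space A0 A1"
  shows "K_functional (interpolation_space A0 A1 \<theta> q0 b0) (interpolation_space A0 A1 \<theta> q1 b1) t f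
       \<le> weighted_K_norm A0 A1 \<theta> q0 b0 {0<..} f"
proof (cases "weighted_K_norm A0 A1 \<theta> q0 b0 {0<..} f < \<infinity>")
  case True
  let ?X0 = "interpolation_space A0 A1 \<theta> q0 b0" and ?X1 = "interpolation_space A0 A1 \<theta> q1 b1"
  note zero = zero_in_interpolation_space[OF assms(1-3), of \<theta> b1]
  have f: "f \<in> points ?X0" using True assms(4) by (simp add: interpolation_space_def)
  have "K_functional ?X0 ?X1 t f \<le> ennreal (qnorm ?X0 f + t * qnorm ?X1 0)"
    unfolding K_functional_def using f zero(1) by (intro Inf_lower) force
  also have "\<dots> = weighted_K_norm A0 A1 \<theta> q0 b0 {0<..} f"
    using True zero(2) by (simp add: interpolation_space_def)
  finally show ?thesis .
qed (simp add: not_less top_unique)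

text \<open>The trivial decomposition \<open>f = 0 + f\<close>.\<close>

lemma K_functional_le_right:
  assumes "quasi_normed_space A0" "quasi_normed_space A1" "0 < q0" "f \<in> sum_space A0 A1" "0 < t"
  shows "K_functional (interpolation_space A0 A1 \<theta> q0 b0) (interpolation_space A0 A1 \<theta> q1 b1) t f
       \<le> ennreal t * weighted_K_norm A0 A1 \<theta> q1 b1 {0<..} f"
proof (cases "weighted_K_norm A0 A1 \<theta> q1 b1 {0<..} f < \<infinity>")
  case True
  let ?X0 = "interpolation_space A0 A1 \<theta> q0 b0" and ?X1 = "interpolation_space A0 A1 \<theta> q1 b1"
  note zero = zero_in_interpolation_space[OF assms(1-3), of \<theta> b0]
  have f: "f \<in> points ?X1" using True assms(4) by (simp add: interpolation_space_def)
  have "K_functional ?X0 ?X1 t f \<le> ennreal (qnorm ?X0 0 + t * qnorm ?X1 f)"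
    unfolding K_functional_def using f zero(1) by (intro Inf_lower) force
  also have "\<dots> = ennreal t * weighted_K_norm A0 A1 \<theta> q1 b1 {0<..} f"
    using True zero(2) assms(5) by (simp add: interpolation_space_def ennreal_mult)
  finally show ?thesis .
qed (use assms(5) in \<open>simp add: not_less top_unique ennreal_mult_top\<close>)

lemma weighted_K_norm_eq:
  "weighted_K_norm A0 A1 \<theta> q b S f = weighted_norm \<theta> q b S (\<lambda>s. K_functional A0 A1 s f)"
  by (simp add: weighted_K_norm_def weighted_norm_def)

text \<open>The constant \<open>c\<close> depends on \<open>\<phi>\<close>, but one choice of \<open>f\<close> and \<open>c\<close> serves for all weighted norms
  at once, since the comparison of \<open>\<phi>\<close> with the \<open>K\<close>-functional is pointwise.\<close>

lemma K_surjective_transfer: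
  assumes A: "quasi_normed_space A0" "quasi_normed_space A1" and surj: "K_surjective A0 A1"
    and "quasi_concave \<phi>"
  obtains f c where "f \<in> sum_space A0 A1" "0 < c"
    and "\<And>\<theta> q b S. \<lbrakk>0 < q; slowly_varying b; S \<subseteq> {0<..}; S \<in> sets borel\<rbrakk> \<Longrightarrow>
      ennreal c * weighted_norm \<theta> q b S (\<lambda>s. ennreal (\<phi> s)) \<le> weighted_K_norm A0 A1 \<theta> q b S f"
    and "\<And>\<theta> q b S. \<lbrakk>0 < q; slowly_varying b; S \<subseteq> {0<..}; S \<in> sets borel\<rbrakk> \<Longrightarrow>
      ennreal c * weighted_K_norm A0 A1 \<theta> q b S f \<le> weighted_norm \<theta> q b S (\<lambda>s. ennreal (\<phi> s))"
proof -
  have "\<exists>f\<in>sum_space A0 A1. approx_on {0<..} (\<lambda>t. ennreal (\<phi> t)) (\<lambda>t. K_functional A0 A1 t f)"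
    using surj \<open>quasi_concave \<phi>\<close> by (simp add: K_surjective_def)
  then obtain f where f: "f \<in> sum_space A0 A1"
    and approx: "approx_on {0<..} (\<lambda>t. ennreal (\<phi> t)) (\<lambda>t. K_functional A0 A1 t f)"
    by (elim bexE)
  obtain c1 c2 :: real where c: "0 < c1" "0 < c2"
    and le: "\<And>s. 0 < s \<Longrightarrow> ennreal (\<phi> s) \<le> ennreal c1 * K_functional A0 A1 s f"
      "\<And>s. 0 < s \<Longrightarrow> K_functional A0 A1 s f \<le> ennreal c2 * ennreal (\<phi> s)"
    using approx unfolding approx_on_def lesssim_on_def by auto
  define c where "c = min (1 / c1) (1 / c2)"
  have "0 < c" "c \<le> 1 / c1" "c \<le> 1 / c2" using c by (auto simp: c_def)
  have scale: "ennreal c * x \<le> y" if "x \<le> ennreal d * y" "c \<le> 1 / d" "0 < d" for x y d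
  proof -
    have "ennreal c * x \<le> ennreal (1 / d) * (ennreal d * y)"
      using that by (intro mult_mono ennreal_leI) auto
    also have "\<dots> = y"
      using that by (simp add: mult.assoc[symmetric] ennreal_mult[symmetric])
    finally show ?thesis .
  qed
  have small: "ennreal c * ennreal (\<phi> s) \<le> K_functional A0 A1 s f"
    "ennreal c * K_functional A0 A1 s f \<le> ennreal (\<phi> s)" if "0 < s" for s
    by (rule scale[OF le(1)[OF that] \<open>c \<le> 1 / c1\<close> c(1)],
        rule scale[OF le(2)[OF that] \<open>c \<le> 1 / c2\<close> c(2)])
  show thesis
  proof (rule that[OF f \<open>0 < c\<close>])
    fix \<theta> and q :: ennreal and b :: "real \<Rightarrow> real" and S :: "real set"
    assume S: "0 < q" "slowly_varying b" "S \<subseteq> {0<..}" "S \<in> sets borel"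
    show "ennreal c * weighted_norm \<theta> q b S (\<lambda>s. ennreal (\<phi> s)) \<le> weighted_K_norm A0 A1 \<theta> q b S f"
      unfolding weighted_K_norm_eq
    proof (rule weighted_norm_mono[OF S(1,2) order_refl S(3,4,4) \<open>0 < c\<close>])
      show "(\<lambda>s. ennreal (\<phi> s)) \<in> borel_measurable (lebesgue_on S)"
        using quasi_concave_measurable[OF \<open>quasi_concave \<phi>\<close> S(3,4)] by measurable
    qed (use S(3) small in auto)
    show "ennreal c * weighted_K_norm A0 A1 \<theta> q b S f \<le> weighted_norm \<theta> q b S (\<lambda>s. ennreal (\<phi> s))"
      unfolding weighted_K_norm_eq
      by (rule weighted_norm_mono[OF S(1,2) order_refl S(3,4,4) \<open>0 < c\<close>
            K_functional_measurable[OF A(2) f S(3,4)]])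
        (use S(3) small in auto)
  qed
qed

section \<open>Estimates transferred to plateaus\<close>

lemma ennreal_le_divide_left:
  assumes "ennreal c * x \<le> y" "0 < c"
  shows "x \<le> ennreal (1 / c) * y"
proof -
  have "x = ennreal (1 / c) * (ennreal c * x)"
    using assms(2) by (simp add: mult.assoc[symmetric] ennreal_mult[symmetric])
  also have "\<dots> \<le> ennreal (1 / c) * y"
    using assms(1) by (rule mult_left_mono) simp
  finally show ?thesis .
qed

text \<open>An estimate between weighted norms of \<open>K\<close>-functionals passes to every single quasi-concave
  function, with a constant depending on that function.\<close>

lemma quasi_concave_norm_transfer:
  assumes A: "quasi_normed_space A0" "quasi_normed_space A1" and surj: "K_surjective A0 A1"
    and q: "0 < q" "0 < q'" and b: "slowly_varying b" "slowly_varying b'" and "0 < c"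
    and S: "\<And>i. i \<in> I \<Longrightarrow> S i \<subseteq> {0<..}" "\<And>i. i \<in> I \<Longrightarrow> S i \<in> sets borel"
    and est: "\<And>f i. f \<in> sum_space A0 A1 \<Longrightarrow> i \<in> I \<Longrightarrow>
      ennreal (v i) * weighted_K_norm A0 A1 \<theta> q' b' (S i) f
        \<le> ennreal c * weighted_K_norm A0 A1 \<theta> q b {0<..} f"
    and \<phi>: "quasi_concave \<phi>" "weighted_norm \<theta> q b {0<..} (\<lambda>s. ennreal (\<phi> s)) < \<infinity>"
  shows "\<exists>C::real. \<forall>i\<in>I. ennreal (v i) * weighted_norm \<theta> q' b' (S i) (\<lambda>s. ennreal (\<phi> s)) \<le> ennreal C"
proof (rule K_surjective_transfer[OF A surj \<phi>(1)])
  fix f e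
  assume f: "f \<in> sum_space A0 A1" and e: "0 < e"
    and lower: "\<And>\<theta> q b S. \<lbrakk>0 < q; slowly_varying b; S \<subseteq> {0<..}; S \<in> sets borel\<rbrakk> \<Longrightarrow>
      ennreal e * weighted_norm \<theta> q b S (\<lambda>s. ennreal (\<phi> s)) \<le> weighted_K_norm A0 A1 \<theta> q b S f"
    and upper: "\<And>\<theta> q b S. \<lbrakk>0 < q; slowly_varying b; S \<subseteq> {0<..}; S \<in> sets borel\<rbrakk> \<Longrightarrow>
      ennreal e * weighted_K_norm A0 A1 \<theta> q b S f \<le> weighted_norm \<theta> q b S (\<lambda>s. ennreal (\<phi> s))"
  let ?n = "weighted_norm \<theta> q b {0<..} (\<lambda>s. ennreal (\<phi> s))"
  let ?X = "ennreal (1 / e) * (ennreal c * (ennreal (1 / e) * ?n))"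
  have "ennreal (v i) * weighted_norm \<theta> q' b' (S i) (\<lambda>s. ennreal (\<phi> s)) \<le> ?X" if "i \<in> I" for i
  proof (rule ennreal_le_divide_left[OF _ e])
    have "ennreal e * (ennreal (v i) * weighted_norm \<theta> q' b' (S i) (\<lambda>s. ennreal (\<phi> s)))
        = ennreal (v i) * (ennreal e * weighted_norm \<theta> q' b' (S i) (\<lambda>s. ennreal (\<phi> s)))"
      by (rule mult.left_commute)
    also have "\<dots> \<le> ennreal (v i) * weighted_K_norm A0 A1 \<theta> q' b' (S i) f"
      by (intro mult_left_mono lower q b S that) simp
    also have "\<dots> \<le> ennreal c * weighted_K_norm A0 A1 \<theta> q b {0<..} f"
      by (rule est[OF f that])
    also have "\<dots> \<le> ennreal c * (ennreal (1 / e) * ?n)"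
      by (intro mult_left_mono ennreal_le_divide_left[OF upper e] q b) auto
    finally show "ennreal e * (ennreal (v i) * weighted_norm \<theta> q' b' (S i) (\<lambda>s. ennreal (\<phi> s)))
        \<le> ennreal c * (ennreal (1 / e) * ?n)" .
  qed
  moreover have "?X < top"
    using \<phi>(2) by (simp add: ennreal_mult_less_top)
  ultimately have "\<forall>i\<in>I. ennreal (v i) * weighted_norm \<theta> q' b' (S i) (\<lambda>s. ennreal (\<phi> s))
      \<le> ennreal (enn2real ?X)"
    by simp
  then show ?thesis by blast
qed

text \<open>Combining the transfer with the uniform boundedness principle removes the dependence of the
  constant on the function, and the norms of the plateaus turn the estimate into an inequality between
  powers of logarithms. Both halves of the estimate to be refuted are instances, with the roles of the
  two weights and exponents exchanged.\<close>

lemma uniform_estimate_plateau: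
  assumes A: "quasi_normed_space A0" "quasi_normed_space A1" and surj: "K_surjective A0 A1"
    and \<theta>: "0 < \<theta>" "\<theta> < 1"
    and q: "0 < q" "0 < q'" and b: "slowly_varying b" "slowly_varying b'" and "0 < c"
    and S: "\<And>i. i \<in> I \<Longrightarrow> S i \<subseteq> {0<..}" "\<And>i. i \<in> I \<Longrightarrow> S i \<in> sets borel"
    and v: "\<And>i. i \<in> I \<Longrightarrow> 0 \<le> v i"
    and est: "\<And>f i. f \<in> sum_space A0 A1 \<Longrightarrow> i \<in> I \<Longrightarrow>
      ennreal (v i) * weighted_K_norm A0 A1 \<theta> q' b' (S i) f
        \<le> ennreal c * weighted_K_norm A0 A1 \<theta> q b {0<..} f"
  shows "\<exists>C>0. \<forall>i\<in>I. \<forall>a T m.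
      0 < a \<and> exp 1 * a \<le> T \<and> {a<..<T} \<subseteq> S i \<and> 0 \<le> m \<and> (\<forall>s\<in>{a<..<T}. m \<le> b' s / b s) \<longrightarrow>
      v i * (m * ln (T / a) powr enn2real (1 / q')) \<le> C * ln (T / a) powr enn2real (1 / q)"
proof (rule uniform_bound_plateau[where I = I and \<theta> = \<theta> and b = b and q = q and
      N = "\<lambda>i \<phi>. ennreal (v i) * weighted_norm \<theta> q' b' (S i) (\<lambda>s. ennreal (\<phi> s))", OF q(1) b(1) \<theta>])
  fix i \<phi> \<psi> and e :: real
  assume i: "i \<in> I" and \<phi>: "quasi_concave \<phi>" and "quasi_concave \<psi>" and e: "0 < e"
    and le: "\<And>s. 0 < s \<Longrightarrow> e * \<phi> s \<le> \<psi> s"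
  have "ennreal e * weighted_norm \<theta> q' b' (S i) (\<lambda>s. ennreal (\<phi> s))
      \<le> weighted_norm \<theta> q' b' (S i) (\<lambda>s. ennreal (\<psi> s))"
  proof (rule weighted_norm_mono[OF q(2) b(2) order_refl S(1)[OF i] S(2)[OF i] S(2)[OF i] e])
    show "(\<lambda>s. ennreal (\<phi> s)) \<in> borel_measurable (lebesgue_on (S i))"
      using quasi_concave_measurable[OF \<phi> S(1)[OF i] S(2)[OF i]] by measurable
    show "ennreal e * ennreal (\<phi> s) \<le> ennreal (\<psi> s)" if "s \<in> S i" for s
      using le[of s] S(1)[OF i] that e by (subst ennreal_mult'[symmetric]) (auto intro: ennreal_leI)
  qed
  from mult_left_mono[OF this, of "ennreal (v i)"]
  show "ennreal e * (ennreal (v i) * weighted_norm \<theta> q' b' (S i) (\<lambda>s. ennreal (\<phi> s)))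
      \<le> ennreal (v i) * weighted_norm \<theta> q' b' (S i) (\<lambda>s. ennreal (\<psi> s))"
    by (simp add: mult.left_commute)
next
  fix \<phi>
  assume "quasi_concave \<phi>" "weighted_norm \<theta> q b {0<..} (\<lambda>s. ennreal (\<phi> s)) < \<infinity>"
  with A surj q b \<open>0 < c\<close> S est
  show "\<exists>C::real. \<forall>i\<in>I. ennreal (v i) * weighted_norm \<theta> q' b' (S i) (\<lambda>s. ennreal (\<phi> s)) \<le> ennreal C"
    by (rule quasi_concave_norm_transfer)
next
  fix C
  assume C: "0 < C" and bound: "\<And>i a T. \<lbrakk>i \<in> I; 0 < a; exp 1 * a \<le> T\<rbrakk> \<Longrightarrow>
      ennreal (v i) * weighted_norm \<theta> q' b' (S i) (\<lambda>s. ennreal (plateau \<theta> b a T s))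
        \<le> ennreal (C * ln (T / a) powr enn2real (1 / q))"
  show ?thesis
  proof (intro exI[of _ C] conjI C ballI allI impI, elim conjE)
    fix i m and a T :: real
    assume i: "i \<in> I" and aT: "0 < a" "exp 1 * a \<le> T" and sub: "{a<..<T} \<subseteq> S i" and m: "0 \<le> m"
      and le: "\<forall>s\<in>{a<..<T}. m \<le> b' s / b s"
    have "S i \<in> sets lebesgue" using S(2)[OF i] by simp
    then have "ennreal (m * ln (T / a) powr enn2real (1 / q'))
        \<le> weighted_norm \<theta> q' b' (S i) (\<lambda>s. ennreal (plateau \<theta> b a T s))"
      using m le by (intro plateau_norm_lower_bound b \<theta> q aT sub) auto
    then have "ennreal (v i) * ennreal (m * ln (T / a) powr enn2real (1 / q'))
        \<le> ennreal (C * ln (T / a) powr enn2real (1 / q))"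
      using bound[OF i aT] by (meson mult_left_mono order_trans zero_le)
    then show "v i * (m * ln (T / a) powr enn2real (1 / q')) \<le> C * ln (T / a) powr enn2real (1 / q)"
      using v[OF i] m C by (simp add: ennreal_mult[symmetric] ennreal_le_iff)
  qed
qed

section \<open>Non-existence of the weight\<close>

theorem theorem3p8:
  fixes A0 A1 :: "'a::hausdorff_tvs qspace"
    and \<theta> :: real and q0 q1 :: ennreal and b0 b1 :: "real \<Rightarrow> real"
  assumes "compatible_couple A0 A1"
    and "K_surjective A0 A1"
    and "0 < \<theta>" and "\<theta> < 1"
    and "0 < q0" and "0 < q1" and "q0 \<noteq> q1"
    and "slowly_varying b0" and "slowly_varying b1"
  shows "\<nexists>w :: real \<Rightarrow> real. (\<forall>t>0. w t > 0) \<and>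
    lesssim_on (sum_space A0 A1 \<times> {0<..})
      (\<lambda>(f, t). weighted_K_norm A0 A1 \<theta> q0 b0 {0<..<t} f
                  + ennreal (w t) * weighted_K_norm A0 A1 \<theta> q1 b1 {t<..} f)
      (\<lambda>(f, t). K_functional (interpolation_space A0 A1 \<theta> q0 b0)
                  (interpolation_space A0 A1 \<theta> q1 b1) (w t) f)"
proof
  assume "\<exists>w :: real \<Rightarrow> real. (\<forall>t>0. w t > 0) \<and>
    lesssim_on (sum_space A0 A1 \<times> {0<..})
      (\<lambda>(f, t). weighted_K_norm A0 A1 \<theta> q0 b0 {0<..<t} f
                  + ennreal (w t) * weighted_K_norm A0 A1 \<theta> q1 b1 {t<..} f)
      (\<lambda>(f, t). K_functional (interpolation_space A0 A1 \<theta> q0 b0)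
                  (interpolation_space A0 A1 \<theta> q1 b1) (w t) f)"
  then obtain w :: "real \<Rightarrow> real" and c :: real
    where w_pos: "\<forall>t>0. 0 < w t" and c: "0 < c"
      and estimate: "\<forall>f\<in>sum_space A0 A1. \<forall>t\<in>{0<..}.
        weighted_K_norm A0 A1 \<theta> q0 b0 {0<..<t} f
            + ennreal (w t) * weighted_K_norm A0 A1 \<theta> q1 b1 {t<..} f
          \<le> ennreal c * K_functional (interpolation_space A0 A1 \<theta> q0 b0)
                  (interpolation_space A0 A1 \<theta> q1 b1) (w t) f"
    unfolding lesssim_on_def by auto
  note w = w_pos[rule_format] and est = estimate[rule_format]
  have A: "quasi_normed_space A0" "quasi_normed_space A1"
    using assms(1) by (auto simp: compatible_couple_def)
  define p0 p1 where "p0 = enn2real (1 / q0)" and "p1 = enn2real (1 / q1)"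
  define r where "r s = b0 s / b1 s" for s
  have b_pos: "0 < b0 s" "0 < b1 s" if "0 < s" for s
    using slowly_varying_pos[OF assms(8) that] slowly_varying_pos[OF assms(9) that] by auto

  have est_right: "ennreal (w t) * weighted_K_norm A0 A1 \<theta> q1 b1 {t<..} f
      \<le> ennreal c * weighted_K_norm A0 A1 \<theta> q0 b0 {0<..} f"
    if "f \<in> sum_space A0 A1" "t \<in> {0<..}" for f t
  proof -
    have "ennreal (w t) * weighted_K_norm A0 A1 \<theta> q1 b1 {t<..} f
        \<le> ennreal c * K_functional (interpolation_space A0 A1 \<theta> q0 b0)
              (interpolation_space A0 A1 \<theta> q1 b1) (w t) f"
      using that by (intro order_trans[OF _ est]) auto
    also have "\<dots> \<le> ennreal c * weighted_K_norm A0 A1 \<theta> q0 b0 {0<..} f"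
      by (intro mult_left_mono K_functional_le_left A assms that) simp
    finally show ?thesis .
  qed
  have "\<exists>C>0. \<forall>t\<in>{0<..}. \<forall>a T m.
      0 < a \<and> exp 1 * a \<le> T \<and> {a<..<T} \<subseteq> {t<..} \<and> 0 \<le> m \<and> (\<forall>s\<in>{a<..<T}. m \<le> b1 s / b0 s) \<longrightarrow>
      w t * (m * ln (T / a) powr p1) \<le> C * ln (T / a) powr p0"
    unfolding p0_def p1_def
    by (rule uniform_estimate_plateau[OF A assms(2-6) assms(8,9) c])
       (use w est_right in \<open>auto intro: less_imp_le\<close>)
  then obtain C1 where "0 < C1" and right:
    "\<And>t a T m. \<lbrakk>0 < t; 0 < a; exp 1 * a \<le> T; {a<..<T} \<subseteq> {t<..}; 0 \<le> m;
        \<forall>s\<in>{a<..<T}. m \<le> b1 s / b0 s\<rbrakk> \<Longrightarrow>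
      w t * (m * ln (T / a) powr p1) \<le> C1 * ln (T / a) powr p0"
    by (metis greaterThan_iff)

  have est_left: "ennreal (1 / w t) * weighted_K_norm A0 A1 \<theta> q0 b0 {0<..<t} f
      \<le> ennreal c * weighted_K_norm A0 A1 \<theta> q1 b1 {0<..} f"
    if "f \<in> sum_space A0 A1" "t \<in> {0<..}" for f t
  proof -
    have "0 < t" "0 < w t" using w that by auto
    have "weighted_K_norm A0 A1 \<theta> q0 b0 {0<..<t} f
        \<le> ennreal c * K_functional (interpolation_space A0 A1 \<theta> q0 b0)
              (interpolation_space A0 A1 \<theta> q1 b1) (w t) f"
      using that by (intro order_trans[OF _ est]) auto
    also have "\<dots> \<le> ennreal c * (ennreal (w t) * weighted_K_norm A0 A1 \<theta> q1 b1 {0<..} f)"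
      by (intro mult_left_mono K_functional_le_right A assms that \<open>0 < w t\<close>) simp
    finally have "ennreal (1 / w t) * weighted_K_norm A0 A1 \<theta> q0 b0 {0<..<t} f
      \<le> ennreal (1 / w t) * (ennreal c * (ennreal (w t) * weighted_K_norm A0 A1 \<theta> q1 b1 {0<..} f))"
      by (rule mult_left_mono) simp
    also have "\<dots> = ennreal c * (ennreal (1 / w t) * ennreal (w t) * weighted_K_norm A0 A1 \<theta> q1 b1 {0<..} f)"
      by (simp only: mult_ac)
    also have "ennreal (1 / w t) * ennreal (w t) = 1"
      using \<open>0 < w t\<close> by (simp add: ennreal_mult[symmetric])
    finally show ?thesis by simp
  qed
  have "\<exists>C>0. \<forall>t\<in>{0<..}. \<forall>a T m.
      0 < a \<and> exp 1 * a \<le> T \<and> {a<..<T} \<subseteq> {0<..<t} \<and> 0 \<le> m \<and> (\<forall>s\<in>{a<..<T}. m \<le> b0 s / b1 s) \<longrightarrow>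
      1 / w t * (m * ln (T / a) powr p0) \<le> C * ln (T / a) powr p1"
    unfolding p0_def p1_def
    by (rule uniform_estimate_plateau[OF A assms(2-4) assms(6,5) assms(9,8) c])
       (use w est_left in \<open>auto intro: less_imp_le\<close>)
  then obtain C0 where C0: "0 < C0" and left:
    "\<And>t a T m. \<lbrakk>0 < t; 0 < a; exp 1 * a \<le> T; {a<..<T} \<subseteq> {0<..<t}; 0 \<le> m;
        \<forall>s\<in>{a<..<T}. m \<le> b0 s / b1 s\<rbrakk> \<Longrightarrow>
      1 / w t * (m * ln (T / a) powr p0) \<le> C0 * ln (T / a) powr p1"
    by (metis greaterThan_iff)

  show False
  proof (rule weight_gap_contradiction[where r = r and w = w and C = "max C0 C1" and p = p0 and p' = p1])
    show "0 < r t" "0 < w t" if "0 < t" for t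
      using b_pos[OF that] w[OF that] by (simp_all add: r_def)
    show "0 < max C0 C1" using C0 by simp
    show "p0 \<noteq> p1"
      using inverse_exponent_inj[OF assms(5,6)] assms(7) by (auto simp: p0_def p1_def)
  next
    fix \<epsilon> :: real assume "0 < \<epsilon>"
    then have "0 < \<epsilon> / 2" by simp
    obtain K0 where K0: "0 < K0"
      "\<And>s u. 0 < s \<Longrightarrow> 0 < u \<Longrightarrow> b0 s \<le> K0 * max (s / u) (u / s) powr (\<epsilon> / 2) * b0 u"
      by (rule slowly_varying_ratio_bound[OF assms(8) \<open>0 < \<epsilon> / 2\<close>]) (rule that)
    obtain K1 where K1: "0 < K1"
      "\<And>s u. 0 < s \<Longrightarrow> 0 < u \<Longrightarrow> b1 s \<le> K1 * max (s / u) (u / s) powr (\<epsilon> / 2) * b1 u"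
      by (rule slowly_varying_ratio_bound[OF assms(9) \<open>0 < \<epsilon> / 2\<close>]) (rule that)
    have "r s \<le> K0 * K1 * max (s / u) (u / s) powr \<epsilon> * r u" if "0 < s" "0 < u" for s u
    proof -
      let ?m = "max (s / u) (u / s) powr (\<epsilon> / 2)"
      have "b0 s * b1 u \<le> (K0 * ?m * b0 u) * (K1 * ?m * b1 s)"
        using K0 K1(1) K1(2)[OF that(2,1)] b_pos[OF that(1)] b_pos[OF that(2)] that
        by (intro mult_mono) (auto simp: max.commute)
      also have "\<dots> = K0 * K1 * (?m * ?m) * b0 u * b1 s"
        by (simp only: mult_ac)
      also have "?m * ?m = max (s / u) (u / s) powr \<epsilon>"
        by (simp flip: powr_add)
      finally show ?thesis
        using b_pos[OF that(1)] b_pos[OF that(2)] by (simp add: r_def field_simps)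
    qed
    then show "\<exists>C>0. \<forall>s u. 0 < s \<longrightarrow> 0 < u \<longrightarrow> r s \<le> C * max (s / u) (u / s) powr \<epsilon> * r u"
      using K0(1) K1(1) by (intro exI[of _ "K0 * K1"]) simp
  next
    fix t a T M
    assume *: "0 < t" "t \<le> a" "exp 1 * a \<le> T" "0 < M" and le: "\<And>s. a < s \<Longrightarrow> s < T \<Longrightarrow> r s \<le> M"
    have "w t * (1 / M * ln (T / a) powr p1) \<le> C1 * ln (T / a) powr p0"
    proof (rule right)
      show "\<forall>s\<in>{a<..<T}. 1 / M \<le> b1 s / b0 s"
      proof
        fix s assume s: "s \<in> {a<..<T}"
        then have "0 < s" "r s \<le> M" using le[of s] * by auto
        then show "1 / M \<le> b1 s / b0 s"
          using b_pos[of s] \<open>0 < M\<close> by (simp add: r_def field_simps)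
      qed
    qed (use * in auto)
    also have "\<dots> \<le> max C0 C1 * ln (T / a) powr p0"
      by (intro mult_right_mono) auto
    finally show "w t * ln (T / a) powr p1 \<le> max C0 C1 * M * ln (T / a) powr p0"
      using \<open>0 < M\<close> by (simp add: pos_divide_le_eq mult_ac)
  next
    fix t a T m
    assume *: "0 < a" "exp 1 * a \<le> T" "T \<le> t" "0 < m" and le: "\<And>s. a < s \<Longrightarrow> s < T \<Longrightarrow> m \<le> r s"
    have "0 < exp 1 * a" using * by simp
    then have "0 < t" using * by linarith
    have "1 / w t * (m * ln (T / a) powr p0) \<le> C0 * ln (T / a) powr p1"
      using * le \<open>0 < t\<close> by (intro left) (auto simp: r_def)
    also have "\<dots> \<le> max C0 C1 * ln (T / a) powr p1"
      by (intro mult_right_mono) auto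
    finally show "m * ln (T / a) powr p0 \<le> max C0 C1 * w t * ln (T / a) powr p1"
      using w[OF \<open>0 < t\<close>] by (simp add: pos_divide_le_eq mult_ac)
  qed
qed

end
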